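(* A finite simple connected undirected graph $G$ is stable (i.e. its vertex spanning polynomial $P_G$ is real stable) if and only if $G$ is distance-hereditary.
   Context: For a finite simple connected undirected graph $G=(V,E)$ with $V=\{1,\dots,n\}$, let $S(G)$ denote the set of all spanning trees of $G$. The vertex spanning polynomial of $G$ is $P_G(x_1,\dots,x_n)=\sum_{T\in S(G)}\prod_{v\in V}x_v^{\deg_T(v)-1}$, where $\deg_T(v)$ is the degree of $v$ in $T$. Let $\mathbb{H}=\{z\in\mathbb{C}: \Im(z)>0\}$. A polynomial $P(x_1,\dots,x_n)$ with real coefficients is called real stable if $P(z_1,\dots,z_n)\neq 0$ whenever $z_1,\dots,z_n\in\mathbb{H}$. A graph $G$ is called stable if $P_G$ is real stable. For $U\subset V$, the induced subgraph $G[U]$ has vertex set $U$ and all edges of $G$ with both endpoints in $U$. A graph $G$ is distance-hereditary if for any connected induced subgraph the distances between its vertices are the same as in $G$. *)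

theory Defs
  imports Complex_Main "HOL-Library.Poly_Mapping"
begin

section \<open>Graphs\<close>

text \<open>
  A graph is given by a vertex set \<open>V\<close> and a set \<open>E\<close> of two-element subsets of \<open>V\<close>.
\<close>

definition simple_graph :: "'a set \<Rightarrow> 'a set set \<Rightarrow> bool" where
  "simple_graph V E \<longleftrightarrow> finite V \<and> V \<noteq> {} \<and> (\<forall>e\<in>E. e \<subseteq> V \<and> card e = 2)"

text \<open>A walk is the nonempty list of its vertices, so it has \<open>length p - 1\<close> edges.\<close>

definition graph_walk :: "'a set \<Rightarrow> 'a set set \<Rightarrow> 'a list \<Rightarrow> bool" where
  "graph_walk V E p \<longleftrightarrow> p \<noteq> [] \<and> set p \<subseteq> V \<and> successively (\<lambda>u v. {u, v} \<in> E) p"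

definition walk_between :: "'a set \<Rightarrow> 'a set set \<Rightarrow> 'a \<Rightarrow> 'a list \<Rightarrow> 'a \<Rightarrow> bool" where
  "walk_between V E u p v \<longleftrightarrow> graph_walk V E p \<and> hd p = u \<and> last p = v"

definition graph_connected :: "'a set \<Rightarrow> 'a set set \<Rightarrow> bool" where
  "graph_connected V E \<longleftrightarrow> (\<forall>u\<in>V. \<forall>v\<in>V. \<exists>p. walk_between V E u p v)"

text \<open>Only meaningful when \<open>u\<close> and \<open>v\<close> are joined by a walk.\<close>

definition graph_dist :: "'a set \<Rightarrow> 'a set set \<Rightarrow> 'a \<Rightarrow> 'a \<Rightarrow> nat" where
  "graph_dist V E u v = (LEAST k. \<exists>p. walk_between V E u p v \<and> length p = Suc k)"

definition induced_edges :: "'a set set \<Rightarrow> 'a set \<Rightarrow> 'a set set" where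
  "induced_edges E U = {e \<in> E. e \<subseteq> U}"

definition distance_hereditary :: "'a set \<Rightarrow> 'a set set \<Rightarrow> bool" where
  "distance_hereditary V E \<longleftrightarrow>
     (\<forall>U\<subseteq>V. graph_connected U (induced_edges E U) \<longrightarrow>
        (\<forall>u\<in>U. \<forall>v\<in>U. graph_dist U (induced_edges E U) u v = graph_dist V E u v))"

text \<open>A cycle is listed without repeating its first vertex at the end.\<close>

definition graph_cycle :: "'a set \<Rightarrow> 'a set set \<Rightarrow> 'a list \<Rightarrow> bool" where
  "graph_cycle V E c \<longleftrightarrow>
     graph_walk V E c \<and> distinct c \<and> length c \<ge> 3 \<and> {last c, hd c} \<in> E"

definition graph_tree :: "'a set \<Rightarrow> 'a set set \<Rightarrow> bool" where
  "graph_tree V F \<longleftrightarrow> graph_connected V F \<and> (\<nexists>c. graph_cycle V F c)"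

text \<open>A spanning tree has vertex set \<open>V\<close> and is therefore identified with its edge set.\<close>

definition spanning_trees :: "'a set \<Rightarrow> 'a set set \<Rightarrow> 'a set set set" where
  "spanning_trees V E = {F. F \<subseteq> E \<and> graph_tree V F}"

definition edge_degree :: "'a set set \<Rightarrow> 'a \<Rightarrow> nat" where
  "edge_degree F v = card {e \<in> F. v \<in> e}"


section \<open>Real polynomials with variables indexed by vertices\<close>

text \<open>
  The exponent vectors are the keys of type \<open>'v \<Rightarrow>\<^sub>0 nat\<close>, and a polynomial maps each exponent
  vector to its coefficient.
\<close>

type_synonym 'v real_mpoly = "('v \<Rightarrow>\<^sub>0 nat) \<Rightarrow>\<^sub>0 real"

definition mpoly_eval :: "('v \<Rightarrow> complex) \<Rightarrow> 'v real_mpoly \<Rightarrow> complex" where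
  "mpoly_eval z P =
     (\<Sum>m\<in>Poly_Mapping.keys P. complex_of_real (Poly_Mapping.lookup P m) *
        (\<Prod>v\<in>Poly_Mapping.keys m. z v ^ Poly_Mapping.lookup m v))"

text \<open>Here \<open>P\<close> is regarded as a polynomial in the variables \<open>x\<^sub>v\<close> with \<open>v \<in> V\<close>.\<close>

definition real_stable :: "'v set \<Rightarrow> 'v real_mpoly \<Rightarrow> bool" where
  "real_stable V P \<longleftrightarrow> (\<forall>z. (\<forall>v\<in>V. Im (z v) > 0) \<longrightarrow> mpoly_eval z P \<noteq> 0)"

text \<open>
  Every vertex of a tree on at least two vertices has positive degree, so the truncated subtraction
  is an ordinary one there. For a single vertex the formula \<open>x\<^sub>v\<^bsup>deg v - 1\<^esup>\<close> would give
  \<open>1 / x\<^sub>v\<close>, which is not a polynomial; here it becomes the constant \<open>1\<close>. Neither vanishes on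
  the upper half-plane.
\<close>

definition vertex_spanning_poly :: "'a set \<Rightarrow> 'a set set \<Rightarrow> 'a real_mpoly" where
  "vertex_spanning_poly V E =
     (\<Sum>F\<in>spanning_trees V E.
        Poly_Mapping.single (\<Sum>v\<in>V. Poly_Mapping.single v (edge_degree F v - 1)) 1)"

definition stable_graph :: "'a set \<Rightarrow> 'a set set \<Rightarrow> bool" where
  "stable_graph V E \<longleftrightarrow> real_stable V (vertex_spanning_poly V E)"

end

theory Submission
  imports
    Defs
    "HOL-Complex_Analysis.Great_Picard"
    "Jordan_Normal_Form.Determinant"
begin

text \<open>
  By the matrix-tree theorem for the edge weights \<open>z\<^sub>u z\<^sub>v\<close>, \<open>P\<^sub>G\<close> vanishes at a point \<open>z\<close> of the
  upper half-plane iff some non-constant \<open>f\<close> satisfies \<open>\<Sum>\<^bsub>w \<sim> v\<^esub> z\<^sub>w (f v - f w) = 0\<close> for all \<open>v\<close>.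
  Hence stability says that all such \<open>harmonic\<close> functions are constant.

  A distance-hereditary graph with at least two vertices has a pendant vertex or a pair of twins.
  A harmonic function takes equal values at a pendant vertex and its neighbour, and at twins \<open>a\<close>
  and \<open>b\<close>, where the equations differ by the factor \<open>f a - f b\<close> times a sum of weights in the upper
  half-plane. The vertex can then be removed, in the case of twins with the new weight
  \<open>z\<^sub>a + z\<^sub>b\<close>.

  Conversely, by Hurwitz' theorem stability passes to connected induced subgraphs, and a graph that
  is not distance-hereditary has an induced house, gem, domino or cycle of length at least \<open>5\<close>, each
  of which carries an explicit non-constant harmonic function.
\<close>

section \<open>Graphs given by an adjacency relation\<close>

text \<open>Orient a spanning tree on at least two vertices towards a root \<open>r\<close>. Every
  other vertex is then the parent of all but one of its tree neighbours, so the product of the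
  weights of the parents is \<open>z r\<close> times the monomial of the tree. This is why
  \<open>z r\<close> times the polynomial is the determinant of the Laplacian without the row and
  column of \<open>r\<close>, once row \<open>v\<close> is divided by \<open>z v\<close>. After this
  division the equation at \<open>v\<close> involves only the weights of the neighbours of
  \<open>v\<close>. So the equations at twins can be compared, and for fixed \<open>f\<close> the
  weights form a kernel vector of a skew-symmetric matrix with entry \<open>f v - f w\<close> at
  each edge. House and gem have five vertices, so this matrix is singular for every
  \<open>f\<close>, and it only remains to reach the upper half-plane. The obstacle in passing to
  subgraphs is that removing a vertex amounts to giving it the weight \<open>0\<close>, which lies
  on the boundary of the upper half-plane.\<close>

locale adjacency =
  fixes A :: "'a \<Rightarrow> 'a \<Rightarrow> bool"
  assumes adj_sym: "A u v \<Longrightarrow> A v u" and adj_irrefl: "\<not> A u u"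
begin

definition rel_on :: "'a set \<Rightarrow> 'a \<Rightarrow> 'a \<Rightarrow> bool" where
  "rel_on U a b \<longleftrightarrow> a \<in> U \<and> b \<in> U \<and> A a b"

definition conn :: "'a set \<Rightarrow> bool" where
  "conn U \<longleftrightarrow> (\<forall>u\<in>U. \<forall>v\<in>U. (rel_on U)\<^sup>*\<^sup>* u v)"

definition dst :: "'a set \<Rightarrow> 'a \<Rightarrow> 'a \<Rightarrow> nat" where
  "dst U u v = (LEAST k. (rel_on U ^^ k) u v)"

definition dist_hered :: "'a set \<Rightarrow> bool" where
  "dist_hered U \<longleftrightarrow> (\<forall>W\<subseteq>U. conn W \<longrightarrow> (\<forall>u\<in>W. \<forall>v\<in>W. dst W u v = dst U u v))"

lemma rel_on_mono: "U \<subseteq> W \<Longrightarrow> rel_on U a b \<Longrightarrow> rel_on W a b"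
  by (auto simp: rel_on_def)

lemma rel_on_reach_mono:
  assumes "(rel_on U)\<^sup>*\<^sup>* a b" "U \<subseteq> W"
  shows "(rel_on W)\<^sup>*\<^sup>* a b"
proof -
  have "rel_on U \<le> rel_on W"
    using assms(2) by (auto simp: rel_on_def)
  then show ?thesis
    using rtranclp_mono assms(1) by (metis predicate2D)
qed

lemma rel_on_reach_sym: "(rel_on U)\<^sup>*\<^sup>* a b \<Longrightarrow> (rel_on U)\<^sup>*\<^sup>* b a"
proof -
  have "symp (rel_on U)" by (auto simp: symp_def rel_on_def intro: adj_sym)
  then show "(rel_on U)\<^sup>*\<^sup>* a b \<Longrightarrow> (rel_on U)\<^sup>*\<^sup>* b a"
    by (metis symp_rtranclp sympD)
qed

lemma connI:
  assumes "\<And>t. t \<in> U \<Longrightarrow> (rel_on U)\<^sup>*\<^sup>* t r"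
  shows "conn U"
  unfolding conn_def using rtranclp_trans[OF assms rel_on_reach_sym[OF assms]] by blast

lemma connD: "conn U \<Longrightarrow> u \<in> U \<Longrightarrow> v \<in> U \<Longrightarrow> (rel_on U)\<^sup>*\<^sup>* u v"
  by (auto simp: conn_def)

lemma conn_neighbour:
  assumes "conn U" "u \<in> U" "v \<in> U" "u \<noteq> v"
  obtains w where "w \<in> U" "A u w"
proof -
  have "(rel_on U)\<^sup>*\<^sup>* u v" using assms connD by blast
  then show ?thesis
    using assms(4) that by (cases rule: converse_rtranclpE) (auto simp: rel_on_def)
qed

lemma dst_relpow:
  assumes "conn U" "u \<in> U" "v \<in> U"
  shows "(rel_on U ^^ dst U u v) u v"
proof -
  obtain n where "(rel_on U ^^ n) u v"
    using assms connD rtranclp_imp_relpowp by metis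
  then show ?thesis unfolding dst_def by (rule LeastI)
qed

lemma dst_le: "(rel_on U ^^ k) u v \<Longrightarrow> dst U u v \<le> k"
  unfolding dst_def by (rule Least_le)

lemma dst_self [simp]: "dst U u u = 0"
  using dst_le[of 0 U u u] by auto

lemma dst_eq_0:
  assumes "conn U" "u \<in> U" "v \<in> U"
  shows "dst U u v = 0 \<longleftrightarrow> u = v"
  using dst_relpow[OF assms] by auto

lemma dst_adj:
  assumes "conn U" "u \<in> U" "v \<in> U" "r \<in> U" "A u v"
  shows "dst U u r \<le> Suc (dst U v r)"
proof -
  have "rel_on U u v" using assms by (auto simp: rel_on_def)
  then show ?thesis
    using dst_relpow[of U v r] assms relpowp_Suc_I2 dst_le by metis
qed

lemma dst_SucE:
  assumes "conn U" "u \<in> U" "r \<in> U" "dst U u r = Suc k"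
  obtains w where "w \<in> U" "A u w" "dst U w r = k"
proof -
  have "(rel_on U ^^ Suc k) u r" using dst_relpow assms by metis
  then obtain w where w: "rel_on U u w" "(rel_on U ^^ k) w r"
    by (meson relpowp_Suc_D2)
  then have "dst U w r \<le> k" "w \<in> U" "A u w" using dst_le by (auto simp: rel_on_def)
  moreover have "Suc k \<le> Suc (dst U w r)" using dst_adj calculation assms by metis
  ultimately show ?thesis using that by auto
qed

lemma dst_eq_1:
  assumes "conn U" "u \<in> U" "v \<in> U"
  shows "dst U u v = Suc 0 \<longleftrightarrow> A u v"
proof
  assume "dst U u v = Suc 0"
  then show "A u v" using dst_SucE[OF assms] dst_eq_0 assms by metis
next
  assume a: "A u v"
  then have "u \<noteq> v" using adj_irrefl by auto
  then show "dst U u v = Suc 0"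
    using dst_adj[OF assms(1,2,3,3) a] dst_eq_0[OF assms] by auto
qed

lemma dst_eq_2:
  assumes "conn U" "u \<in> U" "v \<in> U" "e \<in> U" "u \<noteq> v" "\<not> A u v" "A u e" "A e v"
  shows "dst U u v = Suc (Suc 0)"
proof -
  have "dst U u v \<le> Suc (dst U e v)" using dst_adj assms by metis
  then have "dst U u v \<le> Suc (Suc 0)" using dst_eq_1 assms by metis
  moreover have "dst U u v \<noteq> 0" "dst U u v \<noteq> Suc 0" using dst_eq_0 dst_eq_1 assms by metis+
  ultimately show ?thesis by linarith
qed

section \<open>Distance heredity in terms of distance layers\<close>

lemma dist_hered_subset: "dist_hered V \<Longrightarrow> W \<subseteq> V \<Longrightarrow> conn W \<Longrightarrow> dist_hered W"
proof -
  assume V: "dist_hered V" and W: "W \<subseteq> V" "conn W"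
  have "dst X u v = dst W u v" if X: "X \<subseteq> W" "conn X" "u \<in> X" "v \<in> X" for X u v
  proof -
    have "dst X u v = dst V u v" "dst W u v = dst V u v"
      using V W X unfolding dist_hered_def by (meson subsetD subset_trans)+
    then show ?thesis by simp
  qed
  then show "dist_hered W" unfolding dist_hered_def by blast
qed

text \<open>The form in which heredity is used: distances to \<open>r\<close> are measured in
  \<open>V\<close>, while the next vertex of a shortest path is found inside
  \<open>W\<close>.\<close>

lemma dist_hered_step:
  assumes "dist_hered V" "W \<subseteq> V" "conn W" "u \<in> W" "r \<in> W" "dst V u r = Suc k"
  obtains w where "w \<in> W" "A u w" "dst V w r = k"
proof -
  have eq: "dst W t r = dst V t r" if "t \<in> W" for t
    using assms that by (auto simp: dist_hered_def)
  obtain w where "w \<in> W" "A u w" "dst W w r = k"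
    using dst_SucE assms eq by metis
  then show ?thesis using that eq by auto
qed

text \<open>Inside the induced path the ends \<open>a\<close> and \<open>d\<close> are at distance
  3, but \<open>e\<close> brings them to distance 2. The adjacency of \<open>e\<close> to
  \<open>b\<close> and \<open>c\<close> is left open, so gem, house and cycle of length 5 are
  excluded at once.\<close>

lemma dist_hered_no_P4:
  assumes "dist_hered V" "conn V" "{a, b, c, d, e} \<subseteq> V"
    and "A a b" "A b c" "A c d" "\<not> A a c" "\<not> A b d" "\<not> A a d" "A a e" "A e d"
  shows False
proof -
  let ?W = "{a, b, c, d}"
  have r: "rel_on ?W a b" "rel_on ?W b c" "rel_on ?W c d"
    using assms by (auto simp: rel_on_def)
  have cd: "(rel_on ?W)\<^sup>*\<^sup>* c d" using r by auto
  have bd: "(rel_on ?W)\<^sup>*\<^sup>* b d" using r cd by (meson converse_rtranclp_into_rtranclp)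
  have ad: "(rel_on ?W)\<^sup>*\<^sup>* a d" using r bd by (meson converse_rtranclp_into_rtranclp)
  have conn: "conn ?W" by (rule connI[of _ d]) (use cd bd ad in auto)
  have "a \<noteq> d" using assms adj_sym by blast
  then have "dst V a d = Suc (Suc 0)" using dst_eq_2 assms by auto
  then obtain w where "w \<in> ?W" "A a w" "dst V w d = Suc 0"
    using dist_hered_step[OF assms(1) _ conn, of a d] assms(3) by auto
  then have "dst V b d = Suc 0" using assms adj_irrefl by auto
  then show False using dst_eq_1 assms by auto
qed

text \<open>
  Otherwise \<open>w\<close>, the vertices closer to \<open>r\<close> than \<open>w\<close>, and the vertices joined to \<open>x\<close> at
  distance at least \<open>j\<close> would induce a connected subgraph in which \<open>y\<close> is too far from \<open>r\<close>.
\<close>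

lemma dist_hered_same_lower:
  assumes V: "dist_hered V" "conn V" "r \<in> V"
    and reach: "(rel_on {t \<in> V. j \<le> dst V t r})\<^sup>*\<^sup>* x y"
    and xy: "x \<in> V" "y \<in> V" "dst V x r = j" "dst V y r = j"
    and w: "w \<in> V" "A x w" "Suc (dst V w r) = j"
  shows "A y w"
proof -
  define L where "L = {t \<in> V. j \<le> dst V t r}"
  define C where "C = {t \<in> L. (rel_on L)\<^sup>*\<^sup>* x t}"
  define U where "U = C \<union> {w} \<union> {t \<in> V. Suc (dst V t r) < j}"
  have UV: "U \<subseteq> V" using w by (auto simp: U_def C_def L_def)
  have lower: "(rel_on U)\<^sup>*\<^sup>* t r" if "t \<in> V" "Suc (dst V t r) < j" for t
    using that
  proof (induction "dst V t r" arbitrary: t)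
    case 0
    then have "t = r" using dst_eq_0 V by metis
    then show ?case by auto
  next
    case (Suc k)
    then obtain s where s: "s \<in> V" "A t s" "dst V s r = k" using dst_SucE V by metis
    then have "(rel_on U)\<^sup>*\<^sup>* s r" using Suc by auto
    moreover have "rel_on U t s" using s Suc by (auto simp: rel_on_def U_def)
    ultimately show ?case by (rule converse_rtranclp_into_rtranclp[rotated])
  qed
  have wr: "(rel_on U)\<^sup>*\<^sup>* w r"
  proof (cases "dst V w r")
    case 0
    then have "w = r" using dst_eq_0 V w by metis
    then show ?thesis by auto
  next
    case (Suc k)
    then obtain s where s: "s \<in> V" "A w s" "dst V s r = k" using dst_SucE V w by metis
    then have "(rel_on U)\<^sup>*\<^sup>* s r" using Suc w lower by auto
    moreover have "rel_on U w s" using s Suc w by (auto simp: rel_on_def U_def)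
    ultimately show ?thesis by (rule converse_rtranclp_into_rtranclp[rotated])
  qed
  have xL: "x \<in> L" and yL: "y \<in> L" using xy by (auto simp: L_def)
  have "rel_on U x w" using xL w by (auto simp: rel_on_def U_def C_def)
  then have xr: "(rel_on U)\<^sup>*\<^sup>* x r" using wr by (meson converse_rtranclp_into_rtranclp)
  have xt: "(rel_on U)\<^sup>*\<^sup>* x t" if "(rel_on L)\<^sup>*\<^sup>* x t" for t
    using that
  proof (induction rule: rtranclp_induct)
    case base
    then show ?case by auto
  next
    case (step s t)
    then have "rel_on U s t"
      by (auto simp: rel_on_def U_def C_def intro: rtranclp.rtrancl_into_rtrancl)
    then show ?case using step by auto
  qed
  have "conn U"
  proof (rule connI)
    fix t assume "t \<in> U"
    then consider "t \<in> C" | "t = w" | "t \<in> V" "Suc (dst V t r) < j" by (auto simp: U_def)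
    then show "(rel_on U)\<^sup>*\<^sup>* t r"
    proof cases
      case 1
      then have "(rel_on U)\<^sup>*\<^sup>* t x" using xt rel_on_reach_sym by (auto simp: C_def)
      then show ?thesis using xr by auto
    qed (use lower wr in auto)
  qed
  moreover have "y \<in> U" using reach yL by (auto simp: U_def C_def L_def)
  moreover have "r \<in> U"
  proof (cases "dst V w r = 0")
    case True
    then have "w = r" using dst_eq_0 V w by metis
    then show ?thesis by (auto simp: U_def)
  next
    case False
    then show ?thesis using V w by (auto simp: U_def)
  qed
  ultimately obtain s where s: "s \<in> U" "A y s" "dst V s r = dst V w r"
    using dist_hered_step[OF V(1) UV, of y r "dst V w r"] xy w by metis
  then have "s = w" using w by (auto simp: U_def C_def L_def)
  then show ?thesis using s by auto
qed

text \<open>Converse of \<open>dist_hered_same_lower\<close>. Follow a walk in \<open>W\<close> from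
  \<open>u\<close>, at level \<open>j\<close>, towards \<open>r\<close> until it first drops below
  level \<open>j\<close>. It leaves from a vertex of level \<open>j\<close> that is joined to
  \<open>u\<close> within the levels from \<open>j\<close> on, so the vertex it drops to is also a
  neighbour of \<open>u\<close>. Hence \<open>u\<close> has a neighbour in \<open>W\<close> closer
  to \<open>r\<close>, and induction on the distance applies.\<close>

lemma dist_hered_if_same_lower:
  assumes V: "conn V"
    and same: "\<And>r j x y w. \<lbrakk>r \<in> V; x \<in> V; y \<in> V; w \<in> V; dst V x r = j; dst V y r = j;
        Suc (dst V w r) = j; A x w; (rel_on {t \<in> V. j \<le> dst V t r})\<^sup>*\<^sup>* x y\<rbrakk> \<Longrightarrow> A y w"
  shows "dist_hered V"
proof -
  have "dst W u r = dst V u r" if W: "W \<subseteq> V" "conn W" and r: "r \<in> W" and u: "u \<in> W" for W u r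
  proof (rule antisym)
    have "(rel_on V ^^ dst W u r) u r"
      using relpowp_mono[of "rel_on W" "rel_on V"] dst_relpow[of W u r] that rel_on_mono by blast
    then show "dst V u r \<le> dst W u r" by (rule dst_le)
    have "(rel_on W ^^ dst V u r) u r" using u
    proof (induction "dst V u r" arbitrary: u)
      case 0
      then have "u = r" using dst_eq_0 V W r by (metis subsetD)
      then show ?case by auto
    next
      case (Suc k)
      let ?j = "dst V u r"
      let ?L = "{t \<in> V. ?j \<le> dst V t r}"
      have uV: "u \<in> V" "r \<in> V" using Suc W r by auto
      have "(\<exists>s\<in>W. A u s \<and> dst V s r = k) \<or> ((rel_on ?L)\<^sup>*\<^sup>* u t \<and> ?j \<le> dst V t r)"
        if "(rel_on W)\<^sup>*\<^sup>* u t" for t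
        using that
      proof (induction rule: rtranclp_induct)
        case base
        then show ?case by auto
      next
        case (step t t')
        show ?case
        proof (cases "\<exists>s\<in>W. A u s \<and> dst V s r = k")
          case False
          then have t: "(rel_on ?L)\<^sup>*\<^sup>* u t" "?j \<le> dst V t r" using step by auto
          have tt: "t \<in> W" "t' \<in> W" "A t t'" using step by (auto simp: rel_on_def)
          then have ttV: "t \<in> V" "t' \<in> V" using W by auto
          show ?thesis
          proof (cases "?j \<le> dst V t' r")
            case True
            then have "rel_on ?L t t'" using tt ttV t by (auto simp: rel_on_def)
            then show ?thesis using t(1) True by (meson rtranclp.rtrancl_into_rtrancl)
          next
            case False
            then have d: "dst V t r = ?j" "Suc (dst V t' r) = ?j"
              using dst_adj[OF V ttV uV(2) tt(3)] t(2) by auto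
            have "A u t'"
              by (rule same[OF uV(2) ttV(1) uV(1) ttV(2) d(1) refl d(2) tt(3)])
                 (use t rel_on_reach_sym in auto)
            then show ?thesis using d Suc(2) tt(2) by auto
          qed
        qed auto
      qed
      moreover have "(rel_on W)\<^sup>*\<^sup>* u r" using connD W Suc r by blast
      moreover have "\<not> ?j \<le> dst V r r" using Suc(2) by auto
      ultimately obtain s where s: "s \<in> W" "A u s" "dst V s r = k" by blast
      then have "(rel_on W ^^ k) s r" using Suc by auto
      moreover have "rel_on W u s" using s Suc by (auto simp: rel_on_def)
      ultimately show ?case using Suc(2) relpowp_Suc_I2 by metis
    qed
    then show "dst W u r \<le> dst V u r" by (rule dst_le)
  qed
  then show ?thesis by (auto simp: dist_hered_def)
qed

end

section \<open>Twins in graphs without induced paths on four vertices\<close>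

text \<open>A general relation is taken because the complement is needed as well. The complement of
  an adjacency relation is reflexive, and \<open>distinct\<close> keeps its loops from
  counting.\<close>

definition P4_free :: "('a \<Rightarrow> 'a \<Rightarrow> bool) \<Rightarrow> 'a set \<Rightarrow> bool" where
  "P4_free R M \<longleftrightarrow> \<not> (\<exists>a\<in>M. \<exists>b\<in>M. \<exists>c\<in>M. \<exists>d\<in>M. distinct [a, b, c, d] \<and>
     R a b \<and> R b c \<and> R c d \<and> \<not> R a c \<and> \<not> R b d \<and> \<not> R a d)"

lemma P4_free_subset: "P4_free R M \<Longrightarrow> N \<subseteq> M \<Longrightarrow> P4_free R N"
  unfolding P4_free_def by blast

lemma P4_freeD:
  assumes "P4_free R M" "{a, b, c, d} \<subseteq> M" "distinct [a, b, c, d]"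
    "R a b" "R b c" "R c d" "\<not> R a c" "\<not> R b d"
  shows "R a d"
  using assms unfolding P4_free_def by blast

text \<open>The path on four vertices is self-complementary: a path \<open>a, b, c, d\<close> of
  non-edges is a path \<open>b, d, a, c\<close> of edges.\<close>

lemma P4_free_complement:
  assumes "symp R" "P4_free R M"
  shows "P4_free (\<lambda>a b. \<not> R a b) M"
proof (rule ccontr)
  assume "\<not> P4_free (\<lambda>a b. \<not> R a b) M"
  then obtain a b c d where *: "{a, b, c, d} \<subseteq> M" "distinct [a, b, c, d]"
    "\<not> R a b" "\<not> R b c" "\<not> R c d" "R a c" "R b d" "R a d"
    unfolding P4_free_def by auto
  then have "R d a" "\<not> R b a" "\<not> R d c" using assms(1) by (auto dest: sympD)
  then have "distinct [b, d, a, c] \<and> R b d \<and> R d a \<and> R a c \<and> \<not> R b a \<and> \<not> R d c \<and> \<not> R b c"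
    using * by auto
  then show False using assms(2) *(1) unfolding P4_free_def by blast
qed

text \<open>A nonempty proper union of components; for the complement relation, a set completely
  joined to the rest.\<close>

definition separates :: "('a \<Rightarrow> 'a \<Rightarrow> bool) \<Rightarrow> 'a set \<Rightarrow> 'a set \<Rightarrow> bool" where
  "separates R M S \<longleftrightarrow> S \<subseteq> M \<and> S \<noteq> {} \<and> S \<noteq> M \<and> (\<forall>a\<in>S. \<forall>b\<in>M - S. \<not> R a b)"

text \<open>The critical case is an \<open>x\<close> with a neighbour \<open>y\<close> on one side
  \<open>T\<close> and a non-neighbour on the other side \<open>S\<close>. Then the non-neighbours
  of \<open>x\<close> in \<open>S\<close> are cut off from everything else: an edge from such a
  \<open>v\<close> to a neighbour \<open>u\<close> of \<open>x\<close> in \<open>S\<close> would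
  give the induced path \<open>y, x, u, v\<close>.\<close>

lemma P4_free_separates_insert:
  assumes R: "symp R" and P4: "P4_free R (insert x M)" and x: "x \<notin> M" and S: "separates R M S"
  shows "\<exists>S. separates R (insert x M) S \<or> separates (\<lambda>a b. \<not> R a b) (insert x M) S"
proof -
  have sym: "R a b \<Longrightarrow> R b a" for a b using R by (auto dest: sympD)
  define T where "T = M - S"
  have ST: "S \<inter> T = {}" "S \<union> T = M" "S \<noteq> {}" "T \<noteq> {}"
    "\<And>a b. a \<in> S \<Longrightarrow> b \<in> T \<Longrightarrow> \<not> R a b \<and> \<not> R b a"
    using S sym unfolding separates_def T_def by blast+
  have main: "\<exists>S. separates R (insert x M) S \<or> separates (\<lambda>a b. \<not> R a b) (insert x M) S"
    if ST: "S \<inter> T = {}" "S \<union> T = M" "S \<noteq> {}" "T \<noteq> {}"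
      "\<And>a b. a \<in> S \<Longrightarrow> b \<in> T \<Longrightarrow> \<not> R a b \<and> \<not> R b a"
      and y: "y \<in> T" "R x y" and w: "w \<in> S" "\<not> R x w" for S T y w
  proof -
    define B where "B = {t \<in> S. \<not> R x t}"
    have "\<not> R v u" if "v \<in> B" "u \<in> insert x M - B" for v u
    proof
      assume vu: "R v u"
      have v: "v \<in> S" "\<not> R x v" using that by (auto simp: B_def)
      have "u \<noteq> x" using vu v sym by auto
      moreover have "u \<notin> T" using vu v ST by auto
      ultimately have u: "u \<in> S" "R x u" using that ST by (auto simp: B_def)
      have "x \<noteq> y" "x \<noteq> u" "x \<noteq> v" "y \<noteq> u" "y \<noteq> v" using u v y(1) x ST(1,2) by blast+
      moreover have "u \<noteq> v" using u v by blast
      ultimately have "distinct [y, x, u, v]" by simp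
      moreover have "R y x" "R u v" using sym y vu by blast+
      moreover have "\<not> R y u" "\<not> R y v" using ST(5) u v y by blast+
      moreover have "{y, x, u, v} \<subseteq> insert x M" using u v y ST(2) by blast
      ultimately show False
        using P4_freeD[OF P4, of y x u v] u v by simp
    qed
    moreover have "B \<subseteq> insert x M" "w \<in> B" "x \<notin> B"
      using w x ST(1,2) unfolding B_def by blast+
    ultimately have "separates R (insert x M) B"
      unfolding separates_def by blast
    then show ?thesis by auto
  qed
  consider "\<forall>y\<in>S. \<not> R x y" | "\<forall>y\<in>T. \<not> R x y" | "\<forall>w\<in>M. R x w"
    | y w where "y \<in> T" "R x y" "w \<in> S" "\<not> R x w" | y w where "y \<in> S" "R x y" "w \<in> T" "\<not> R x w"
    using ST by blast
  then show ?thesis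
  proof cases
    case 1
    then have "separates R (insert x M) S" using ST x sym unfolding separates_def by blast
    then show ?thesis by auto
  next
    case 2
    then have "separates R (insert x M) T" using ST x sym unfolding separates_def by blast
    then show ?thesis by auto
  next
    case 3
    then have "separates (\<lambda>a b. \<not> R a b) (insert x M) {x}" using ST x by (auto simp: separates_def)
    then show ?thesis by auto
  next
    case 4
    then show ?thesis using main[OF ST] by blast
  next
    case 5
    then show ?thesis using main[of T S] ST by blast
  qed
qed

text \<open>Seinsche's theorem: the graph or its complement is disconnected. As the hypothesis is
  invariant under complementation, the induction step only has to treat a disconnected
  graph.\<close>

lemma P4_free_separates:
  assumes "finite M" "card M \<ge> 2" "symp R" "P4_free R M"
  shows "\<exists>S. separates R M S \<or> separates (\<lambda>a b. \<not> R a b) M S"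
  using assms
proof (induction M rule: finite_induct)
  case empty
  then show ?case by auto
next
  case (insert x M)
  have symn: "symp (\<lambda>a b. \<not> R a b)" using insert by (auto simp: symp_def)
  show ?case
  proof (cases "card M \<ge> 2")
    case True
    then obtain S where "separates R M S \<or> separates (\<lambda>a b. \<not> R a b) M S"
      using insert P4_free_subset by (metis subset_insertI)
    then show ?thesis
    proof
      assume "separates R M S"
      then show ?thesis using P4_free_separates_insert insert by metis
    next
      assume "separates (\<lambda>a b. \<not> R a b) M S"
      then show ?thesis
        using P4_free_separates_insert[OF symn P4_free_complement] insert by fastforce
    qed
  next
    case False
    then have "card M = 1" using insert by auto
    then obtain y where M: "M = {y}" by (auto simp: card_1_singleton_iff)
    then have "separates R (insert x M) {x} \<or> separates (\<lambda>a b. \<not> R a b) (insert x M) {x}"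
      using insert by (auto simp: separates_def)
    then show ?thesis by auto
  qed
qed

text \<open>All pairs between \<open>S\<close> and \<open>M - S\<close> are related alike, so twins
  found in either part remain twins in \<open>M\<close>. If both parts are singletons, their
  elements are twins trivially.\<close>

lemma P4_free_twins:
  assumes "finite M" "card M \<ge> 2" "symp R" "P4_free R M"
  shows "\<exists>a\<in>M. \<exists>b\<in>M. a \<noteq> b \<and> (\<forall>x\<in>M - {a, b}. R a x \<longleftrightarrow> R b x)"
  using assms
proof (induction "card M" arbitrary: M rule: less_induct)
  case less
  have sym: "R a b \<longleftrightarrow> R b a" for a b using less by (auto dest: sympD)
  obtain S where "separates R M S \<or> separates (\<lambda>a b. \<not> R a b) M S"
    using P4_free_separates less by metis
  then have S: "S \<subseteq> M" "S \<noteq> {}" "M - S \<noteq> {}"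
    and same: "\<And>a b c d. \<lbrakk>a \<in> S; b \<in> M - S; c \<in> S; d \<in> M - S\<rbrakk> \<Longrightarrow> R a b \<longleftrightarrow> R c d"
    by (auto simp: separates_def)
  have fin: "finite S" "finite (M - S)" using less S by (auto intro: finite_subset)
  have card: "card S < card M" "card (M - S) < card M"
    using S less by (auto intro!: psubset_card_mono)
  show ?case
  proof (cases "card S \<ge> 2")
    case True
    then obtain a b where ab: "a \<in> S" "b \<in> S" "a \<noteq> b" "\<forall>x\<in>S - {a, b}. R a x \<longleftrightarrow> R b x"
      using less(1)[OF card(1) fin(1)] less P4_free_subset S by metis
    then have "\<forall>x\<in>M - {a, b}. R a x \<longleftrightarrow> R b x" using same S(1) by blast
    then show ?thesis using ab S by blast
  next
    case S1: False
    show ?thesis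
    proof (cases "card (M - S) \<ge> 2")
      case True
      then obtain a b where ab: "a \<in> M - S" "b \<in> M - S" "a \<noteq> b"
        "\<forall>x\<in>M - S - {a, b}. R a x \<longleftrightarrow> R b x"
        using less(1)[OF card(2) fin(2)] less P4_free_subset by (metis Diff_subset)
      then have "\<forall>x\<in>M - {a, b}. R a x \<longleftrightarrow> R b x" using same sym S(1) by blast
      then show ?thesis using ab S by blast
    next
      case False
      have "card S = 1" "card (M - S) = 1"
        using S1 False S fin card_gt_0_iff[of S] card_gt_0_iff[of "M - S"] by linarith+
      then obtain a b where "S = {a}" "M - S = {b}" by (auto simp: card_1_singleton_iff)
      then have "M = {a, b}" "a \<noteq> b" using S by auto
      then show ?thesis by auto
    qed
  qed
qed

section \<open>Modules and the existence of a pendant vertex or of twins\<close>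

context adjacency
begin

text \<open>The last hypothesis makes \<open>M\<close> a module: vertices outside do not tell its
  elements apart, so twins in \<open>M\<close> are twins in \<open>V\<close>.\<close>

lemma module_twins:
  assumes "finite M" "card M \<ge> 2" "P4_free A M" "M \<subseteq> V"
    and "\<And>a b y. \<lbrakk>a \<in> M; b \<in> M; y \<in> V - M; A y a\<rbrakk> \<Longrightarrow> A y b"
  shows "\<exists>a\<in>V. \<exists>b\<in>V. a \<noteq> b \<and> (\<forall>x\<in>V - {a, b}. A a x \<longleftrightarrow> A b x)"
proof -
  have "symp A" using adj_sym by (auto simp: symp_def)
  then obtain a b where ab: "a \<in> M" "b \<in> M" "a \<noteq> b" "\<forall>x\<in>M - {a, b}. A a x \<longleftrightarrow> A b x"
    using P4_free_twins assms by metis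
  then have "\<forall>x\<in>V - {a, b}. A a x \<longleftrightarrow> A b x"
    using assms(5) adj_sym by blast
  then show ?thesis using ab assms by blast
qed

text \<open>Together with \<open>e\<close>, an induced path on four vertices in \<open>M\<close>
  would form a gem.\<close>

lemma dist_hered_P4_free_neighbours:
  assumes "dist_hered V" "conn V" "M \<subseteq> V" "e \<in> V" "\<And>m. m \<in> M \<Longrightarrow> A e m"
  shows "P4_free A M"
proof (rule ccontr)
  assume "\<not> P4_free A M"
  then obtain a b c d where *: "a \<in> M" "b \<in> M" "c \<in> M" "d \<in> M"
    "A a b" "A b c" "A c d" "\<not> A a c" "\<not> A b d" "\<not> A a d"
    unfolding P4_free_def by auto
  moreover have "A a e" "A e d" using * assms adj_sym by auto
  ultimately show False using dist_hered_no_P4[OF assms(1,2), of a b c d e] assms(3,4) by auto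
qed


text \<open>
  The twins are found in the last level \<open>k\<close> of the distance layering from \<open>r\<close> if it contains
  an edge, and otherwise in the neighbourhood, within level \<open>k - 1\<close>, of a vertex of level \<open>k\<close>
  with as few neighbours as possible.
\<close>

lemma dist_hered_pendant_or_twins:
  assumes V: "finite V" "conn V" "dist_hered V" "card V \<ge> 2"
  shows "(\<exists>v\<in>V. \<exists>u\<in>V. u \<noteq> v \<and> (\<forall>x\<in>V. A v x \<longleftrightarrow> x = u)) \<or>
         (\<exists>a\<in>V. \<exists>b\<in>V. a \<noteq> b \<and> (\<forall>x\<in>V - {a, b}. A a x \<longleftrightarrow> A b x))"
proof -
  obtain r where r: "r \<in> V" using V by fastforce
  define d where "d t = dst V t r" for t
  define k where "k = Max (d ` V)"
  have d_le: "d t \<le> k" if "t \<in> V" for t using that V by (auto simp: k_def)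
  have d0: "d t = 0 \<longleftrightarrow> t = r" if "t \<in> V" for t using that dst_eq_0 V r by (auto simp: d_def)
  have d_adj: "d u \<le> Suc (d v)" if "u \<in> V" "v \<in> V" "A u v" for u v
    using that dst_adj V r by (auto simp: d_def)
  have d_Suc: "\<exists>w\<in>V. A u w \<and> d w = m" if "u \<in> V" "d u = Suc m" for u m
    using that dst_SucE V r by (metis d_def)
  obtain s where s: "s \<in> V" "d s = k"
  proof -
    have "Max (d ` V) \<in> d ` V" using V r by (intro Max_in) auto
    then show ?thesis using that by (auto simp: k_def)
  qed
  have "k \<noteq> 0"
  proof
    assume "k = 0"
    then have "t = r" if "t \<in> V" for t using d_le[OF that] d0[OF that] by simp
    then have "V \<subseteq> {r}" by blast
    then have "card V \<le> card {r}" by (intro card_mono) auto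
    then show False using V by auto
  qed
  then obtain k' where k': "k = Suc k'" by (cases k) auto
  define L where "L j = {t \<in> V. j \<le> d t}" for j
  have same: "A y w"
    if "(rel_on (L j))\<^sup>*\<^sup>* x y" "x \<in> V" "y \<in> V" "d x = j" "d y = j" "w \<in> V" "A x w" "Suc (d w) = j"
    for j x y w
    using dist_hered_same_lower[OF V(3,2) r, of j x y w] that by (auto simp: L_def d_def)
  show ?thesis
  proof (cases "\<exists>x\<in>V. \<exists>y\<in>V. d x = k \<and> d y = k \<and> A x y")
    case True
    then obtain x y where xy: "x \<in> V" "y \<in> V" "d x = k" "d y = k" "A x y" by blast
    define M where "M = {t \<in> V. (rel_on (L k))\<^sup>*\<^sup>* x t}"
    have M_sub: "M \<subseteq> L k"
    proof
      fix t assume "t \<in> M"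
      then have "(rel_on (L k))\<^sup>*\<^sup>* x t" by (auto simp: M_def)
      then show "t \<in> L k"
        by (cases rule: rtranclp.cases) (use xy in \<open>auto simp: rel_on_def L_def\<close>)
    qed
    then have dM: "t \<in> V \<and> d t = k" if "t \<in> M" for t
      using that d_le by (fastforce simp: L_def)
    have M_V: "M \<subseteq> V" by (auto simp: M_def)
    have reach: "(rel_on (L k))\<^sup>*\<^sup>* a b" if "a \<in> M" "b \<in> M" for a b
      using that rel_on_reach_sym by (auto simp: M_def intro: rtranclp_trans)
    have "x \<in> M" "y \<in> M" using xy by (auto simp: M_def rel_on_def L_def)
    moreover have "x \<noteq> y" using xy adj_irrefl by auto
    moreover have finM: "finite M" using V by (auto simp: M_def)
    ultimately have cardM: "card M \<ge> 2"
      by (metis card_le_Suc0_iff_eq not_less_eq_eq numeral_2_eq_2)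
    obtain w where w: "w \<in> V" "A x w" "d w = k'" using d_Suc xy k' by metis
    have "A w m" if "m \<in> M" for m
      using same[OF reach[OF \<open>x \<in> M\<close> that], of w] that dM w k' xy adj_sym by blast
    then have P4: "P4_free A M"
      using dist_hered_P4_free_neighbours[OF V(3,2)] dM w by (metis subsetI)
    have "A t b" if ab: "a \<in> M" "b \<in> M" and t: "t \<in> V - M" "A t a" for a b t
    proof (cases "d t = k")
      case True
      then have "rel_on (L k) a t" using ab t dM adj_sym by (auto simp: rel_on_def L_def)
      then have "t \<in> M" using ab t
        by (auto simp: M_def intro: rtranclp.rtrancl_into_rtrancl)
      then show ?thesis using t by auto
    next
      case False
      moreover have "d a \<le> Suc (d t)" using d_adj[of a t] ab t dM adj_sym by blast
      moreover have "d t \<le> k" "d a = k" using d_le t dM ab by blast+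
      ultimately have "Suc (d t) = k" by linarith
      moreover have "t \<in> V" "a \<in> V" "b \<in> V" "d b = k" "A a t"
        using ab t dM adj_sym by blast+
      ultimately have "A b t" using same[OF reach[OF ab], of t] \<open>d a = k\<close> by simp
      then show ?thesis by (rule adj_sym)
    qed
    then have "\<exists>a\<in>V. \<exists>b\<in>V. a \<noteq> b \<and> (\<forall>x\<in>V - {a, b}. A a x \<longleftrightarrow> A b x)"
      using module_twins[OF finM cardM P4 M_V] by blast
    then show ?thesis ..
  next
    case False
    then have indep: "\<not> A x y" if "x \<in> V" "y \<in> V" "d x = k" "d y = k" for x y using that by blast
    define N where "N t = {u \<in> V. A t u}" for t
    have finN: "finite (N t)" for t using V by (auto simp: N_def)
    \<comment> \<open>The minimal choice pays off for a vertex \<open>y\<close> of level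
      \<open>k\<close> below: if \<open>y\<close> misses some \<open>b\<close> in
      \<open>N v\<close>, it has a neighbour outside \<open>N v\<close>.\<close>
    obtain v where v: "v \<in> V" "d v = k"
      and vmin: "\<And>t. t \<in> V \<Longrightarrow> d t = k \<Longrightarrow> card (N v) \<le> card (N t)"
      using arg_min_nat_lemma[of "\<lambda>t. t \<in> V \<and> d t = k" s "\<lambda>t. card (N t)"] s by blast
    have Nk: "d u = k'" if "t \<in> V" "d t = k" "u \<in> N t" for t u
    proof -
      have "u \<in> V" "A t u" using that by (auto simp: N_def)
      then have "d u \<noteq> k" "d u \<le> k" "d t \<le> Suc (d u)"
        using that(1,2) indep[of t u] d_le[of u] d_adj[of t u] by blast+
      then show ?thesis using that k' by linarith
    qed
    obtain w where w: "w \<in> N v" using d_Suc v k' by (auto simp: N_def)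
    show ?thesis
    proof (cases "card (N v) \<ge> 2")
      case False
      then have "card (N v) = 1"
        using w finN card_gt_0_iff[of "N v"] by fastforce
      then have "N v = {w}" using w by (auto simp: card_1_singleton_iff)
      then have "w \<in> V \<and> w \<noteq> v \<and> (\<forall>x\<in>V. A v x \<longleftrightarrow> x = w)"
        using adj_irrefl by (auto simp: N_def)
      then show ?thesis using v by blast
    next
      case card: True
      have "k' \<noteq> 0"
      proof
        assume "k' = 0"
        then have "N v \<subseteq> {r}" using Nk v d0 by (auto simp: N_def)
        then have "card (N v) \<le> card {r}" by (intro card_mono) auto
        then show False using card by auto
      qed
      then obtain k'' where k'': "k' = Suc k''" by (cases k') auto
      have step: "(rel_on (L k'))\<^sup>*\<^sup>* a b" if "A a b" "a \<in> V" "b \<in> V" "k' \<le> d a" "k' \<le> d b" for a b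
        using that by (auto simp: rel_on_def L_def)
      have NV: "a \<in> V" "A v a" "A a v" "d a = k'" if "a \<in> N v" for a
        using that Nk v adj_sym by (auto simp: N_def)
      have ab_reach: "(rel_on (L k'))\<^sup>*\<^sup>* a b" if "a \<in> N v" "b \<in> N v" for a b
        by (rule rtranclp_trans[of _ _ v]; rule step)
           (use NV[OF that(1)] NV[OF that(2)] v k' in simp_all)
      \<comment> \<open>\<open>N v\<close> is a module: a vertex \<open>y\<close> telling
        \<open>a\<close> and \<open>b\<close> apart is refuted according to its level. In the two
        upper levels a common neighbour \<open>c\<close> of \<open>a\<close> and \<open>b\<close> in
        level \<open>k - 2\<close> helps.\<close>
      have "A y b" if ab: "a \<in> N v" "b \<in> N v" and y: "y \<in> V - N v" "A y a" for a b y
      proof (rule ccontr)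
        assume nyb: "\<not> A y b"
        have yv: "y \<noteq> v" "\<not> A y v" "\<not> A v y"
          using nyb NV(2)[OF ab(2)] y(1) adj_sym by (auto simp: N_def)
        obtain c where c: "c \<in> V" "A a c" "d c = k''" using d_Suc NV ab k'' by metis
        have "d y \<le> Suc (d a)" "d a \<le> Suc (d y)" using d_adj NV(1)[OF ab(1)] y adj_sym by blast+
        then consider "d y = k''" | "d y = k'" | "d y = k" using NV(4)[OF ab(1)] k' k'' by linarith
        then show False
        proof cases
          case 1
          then show ?thesis
            using same[OF ab_reach[OF ab], of y] NV ab y nyb k'' adj_sym by blast
        next
          case 2
          have cb: "A b c" using same[OF ab_reach[OF ab], of c] NV ab c k'' by blast
          have "A y c"
            using same[OF step, of a y c] NV(1,4)[OF ab(1)] c k'' y 2 adj_sym by auto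
          moreover have "\<not> A c v" "\<not> A v c" using c v d_adj[of v c] k' k'' by (auto dest: adj_sym)
          ultimately show ?thesis
          proof (cases "A a b")
            case True
            then show ?thesis
              using dist_hered_no_P4[OF V(3,2), of y c b v a] NV ab c v y yv nyb cb \<open>A y c\<close>
                \<open>\<not> A c v\<close> adj_sym by blast
          next
            case False
            then show ?thesis
              using dist_hered_no_P4[OF V(3,2), of y a v b c] NV ab c v y yv nyb cb \<open>A y c\<close>
                adj_sym by blast
          qed
        next
          case 3
          have "\<not> N y \<subseteq> N v"
          proof
            assume "N y \<subseteq> N v"
            moreover have "b \<in> N v - N y" using nyb ab by (auto simp: N_def)
            ultimately have "card (N y) < card (N v)" using finN by (metis Diff_iff psubsetI psubset_card_mono)
            then show False using vmin[of y] y 3 by auto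
          qed
          then obtain e where e: "e \<in> N y" "e \<notin> N v" by auto
          then have eV: "e \<in> V" "A y e" "\<not> A v e" "d e = k'" using Nk y 3 by (auto simp: N_def)
          have ae: "(rel_on (L k'))\<^sup>*\<^sup>* a e"
            by (rule rtranclp_trans[of _ _ y]; rule step)
               (use NV[OF ab(1)] eV y 3 k' adj_sym[OF y(2)] in simp_all)
          have bc: "A b c" using same[OF ab_reach[OF ab], of c] NV ab c k'' by blast
          have ec: "A e c" using same[OF ae] NV ab c k'' eV by auto
          have vc: "\<not> A v c" using c v d_adj[of v c] k' k'' by auto
          show False
          proof (cases "A b e")
            case True
            have "A v b" "A b e" "A e y" "\<not> A v e" "\<not> A b y" "\<not> A v y" "A v a" "A a y"
              using True NV ab eV nyb yv y adj_sym by blast+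
            then show ?thesis
              using dist_hered_no_P4[OF V(3,2), of v b e y a] NV(1) ab v y eV by blast
          next
            case False
            \<comment> \<open>\<open>?W\<close> carries the path \<open>b, v, a, y, e\<close>, while
              \<open>b\<close> and \<open>e\<close> are at distance 2 through \<open>c\<close>. By
              heredity they have a common neighbour inside \<open>?W\<close>, which can only be
              \<open>a\<close>.\<close>
            let ?W = "{b, v, a, y, e}"
            have rel: "rel_on ?W b v" "rel_on ?W v a" "rel_on ?W a y" "rel_on ?W y e"
              using NV ab y eV adj_sym by (auto simp: rel_on_def)
            have r1: "(rel_on ?W)\<^sup>*\<^sup>* y e" using rel by auto
            have r2: "(rel_on ?W)\<^sup>*\<^sup>* a e" using rel r1 by (meson converse_rtranclp_into_rtranclp)
            have r3: "(rel_on ?W)\<^sup>*\<^sup>* v e" using rel r2 by (meson converse_rtranclp_into_rtranclp)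
            have r4: "(rel_on ?W)\<^sup>*\<^sup>* b e" using rel r3 by (meson converse_rtranclp_into_rtranclp)
            have "conn ?W" by (rule connI[of _ e]) (use r1 r2 r3 r4 in auto)
            moreover have "dst V b e = Suc (Suc 0)"
              using dst_eq_2[OF V(2), of b e c] NV ab eV c bc ec False e adj_sym by blast
            moreover have "?W \<subseteq> V" using NV ab v y eV by auto
            ultimately obtain t where t: "t \<in> ?W" "A b t" "dst V t e = Suc 0"
              using dist_hered_step[OF V(3), of ?W b e] by auto
            then have "A t e" using dst_eq_1[OF V(2)] \<open>?W \<subseteq> V\<close> eV by (meson subsetD)
            then have "t = a" using t nyb eV False adj_irrefl adj_sym by blast
            then have "A a b" "A a e" using t \<open>A t e\<close> adj_sym by auto
            then show ?thesis
              using dist_hered_no_P4[OF V(3,2), of v b c e a] NV ab v c eV bc ec vc False adj_sym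
              by blast
          qed
        qed
      qed
      moreover have N_sub: "N v \<subseteq> V" by (auto simp: N_def)
      moreover have "P4_free A (N v)"
        by (rule dist_hered_P4_free_neighbours[OF V(3,2) N_sub v(1)]) (simp add: N_def)
      ultimately have "\<exists>a\<in>V. \<exists>b\<in>V. a \<noteq> b \<and> (\<forall>x\<in>V - {a, b}. A a x \<longleftrightarrow> A b x)"
        using module_twins[OF finN card _ N_sub] by blast
      then show ?thesis ..
    qed
  qed
qed

end

section \<open>Harmonic functions\<close>

context adjacency
begin

definition harmonic :: "'a set \<Rightarrow> ('a \<Rightarrow> complex) \<Rightarrow> ('a \<Rightarrow> complex) \<Rightarrow> bool" where
  "harmonic U z f \<longleftrightarrow> (\<forall>v\<in>U. (\<Sum>w\<in>U. if A v w then z w * (f v - f w) else 0) = 0)"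

definition rigid :: "'a set \<Rightarrow> bool" where
  "rigid U \<longleftrightarrow> (\<forall>z f. (\<forall>v\<in>U. 0 < Im (z v)) \<longrightarrow> harmonic U z f \<longrightarrow> (\<forall>u\<in>U. \<forall>v\<in>U. f u = f v))"

text \<open>Replacing \<open>v\<close> by \<open>u\<close> turns a walk into a walk, up to repeated
  vertices. The condition covers both a pendant vertex \<open>v\<close> with neighbour
  \<open>u\<close> and twins \<open>u\<close>, \<open>v\<close>.\<close>

lemma conn_Diff_dominated:
  assumes V: "conn V" and uv: "u \<in> V" "u \<noteq> v"
    and dom: "\<And>x. x \<in> V - {u, v} \<Longrightarrow> A v x \<Longrightarrow> A u x"
  shows "conn (V - {v})"
proof -
  define g where "g x = (if x = v then u else x)" for x
  have "(rel_on (V - {v}))\<^sup>*\<^sup>* (g x) (g y)" if "(rel_on V)\<^sup>*\<^sup>* x y" for x y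
    using that
  proof (induction rule: rtranclp_induct)
    case base
    then show ?case by simp
  next
    case (step y t)
    have yt: "y \<in> V" "t \<in> V" "A y t" using step by (auto simp: rel_on_def)
    have "g y = g t \<or> A (g y) (g t)"
    proof (cases "y = v")
      case True
      then show ?thesis using yt dom[of t] adj_irrefl by (auto simp: g_def)
    next
      case False
      then show ?thesis using yt dom[of y] adj_sym[of y v] adj_sym[of u y] by (auto simp: g_def)
    qed
    moreover have "g y \<in> V - {v}" "g t \<in> V - {v}" using yt uv by (auto simp: g_def)
    ultimately have "g y = g t \<or> rel_on (V - {v}) (g y) (g t)" by (auto simp: rel_on_def)
    then show ?case using step.IH by (metis rtranclp.rtrancl_into_rtrancl)
  qed
  then show ?thesis
    unfolding conn_def using connD[OF V] by (metis DiffE g_def insertI1)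
qed

lemma rigidD:
  "rigid U \<Longrightarrow> (\<And>v. v \<in> U \<Longrightarrow> 0 < Im (z v)) \<Longrightarrow> harmonic U z f \<Longrightarrow> u \<in> U \<Longrightarrow> v \<in> U \<Longrightarrow> f u = f v"
  unfolding rigid_def by blast

lemma rigid_pendant:
  assumes V: "finite V" and rigid: "rigid (V - {v})"
    and v: "v \<in> V" "u \<in> V" "u \<noteq> v" and pendant: "\<And>x. x \<in> V \<Longrightarrow> A v x \<longleftrightarrow> x = u"
  shows "rigid V"
  unfolding rigid_def
proof (intro allI impI)
  fix z f assume z: "\<forall>v\<in>V. 0 < Im (z v)" and harm: "harmonic V z f"
  have "(\<Sum>w\<in>V. if A v w then z w * (f v - f w) else 0) = 0"
    using harm v unfolding harmonic_def by blast
  moreover have "(\<Sum>w\<in>V. if A v w then z w * (f v - f w) else 0) =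
      (\<Sum>w\<in>V. if w = u then z w * (f v - f w) else 0)"
    by (intro sum.cong) (use pendant in auto)
  ultimately have "z u * (f v - f u) = 0" using V v by simp
  moreover have "z u \<noteq> 0" using z v by force
  ultimately have fvu: "f v = f u" by simp
  have "harmonic (V - {v}) z f"
    unfolding harmonic_def
  proof
    fix x assume x: "x \<in> V - {v}"
    have "(if A x v then z v * (f x - f v) else 0) = 0"
      using pendant[of x] x adj_sym fvu by auto
    then have "(\<Sum>w\<in>V - {v}. if A x w then z w * (f x - f w) else 0) =
        (\<Sum>w\<in>V. if A x w then z w * (f x - f w) else 0)"
      using sum.remove[OF V v(1), of "\<lambda>w. if A x w then z w * (f x - f w) else 0"] by simp
    then show "(\<Sum>w\<in>V - {v}. if A x w then z w * (f x - f w) else 0) = 0"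
      using harm x unfolding harmonic_def by simp
  qed
  then have "f x = f u" if "x \<in> V - {v}" for x
    using rigidD[OF rigid, of z f x u] z v that by blast
  then have const: "f x = f u" if "x \<in> V" for x
    using fvu that by (cases "x = v") auto
  show "\<forall>u\<in>V. \<forall>v\<in>V. f u = f v"
    by (intro ballI) (rule trans[OF const const[symmetric]])
qed

lemma rigid_twins:
  assumes V: "finite V" "conn V" and rigid: "rigid (V - {b})"
    and ab: "a \<in> V" "b \<in> V" "a \<noteq> b" and twins: "\<And>x. x \<in> V - {a, b} \<Longrightarrow> A a x \<longleftrightarrow> A b x"
  shows "rigid V"
  unfolding rigid_def
proof (intro allI impI)
  fix z f assume z: "\<forall>v\<in>V. 0 < Im (z v)" and harm: "harmonic V z f"
  define V' where "V' = V - {a, b}"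
  have V': "finite V'" using V by (simp add: V'_def)
  have split: "(\<Sum>w\<in>V. h w) = h a + h b + (\<Sum>w\<in>V'. h w)" for h :: "'a \<Rightarrow> complex"
  proof -
    have eq: "V = insert a (insert b V')" "a \<notin> insert b V'" "b \<notin> V'"
      using ab by (auto simp: V'_def)
    show ?thesis using V' eq(2,3) by (subst eq(1)) (simp add: add.assoc)
  qed
  define s where "s = (\<Sum>w\<in>V'. if A a w then z w else 0)"
  \<comment> \<open>If the twins are adjacent, the terms of the edge between them,
    \<open>z b * (f a - f b)\<close> and \<open>z a * (f b - f a)\<close>, differ by
    \<open>t * (f a - f b)\<close>.\<close>
  define t where "t = (if A a b then z a + z b else 0)"
  have eqs: "(\<Sum>w\<in>V. if A a w then z w * (f a - f w) else 0) = 0"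
    "(\<Sum>w\<in>V. if A b w then z w * (f b - f w) else 0) = 0"
    using harm ab unfolding harmonic_def by blast+
  define X where "X c = (\<Sum>w\<in>V'. if A c w then z w * (f c - f w) else 0)" for c
  have diff: "s * (f a - f b) = X a - X b"
    unfolding s_def X_def sum_distrib_right sum_subtractf[symmetric]
    by (intro sum.cong) (use twins in \<open>auto simp: V'_def algebra_simps\<close>)
  have "X a + (if A a b then z b * (f a - f b) else 0) = 0"
    "X b + (if A a b then z a * (f b - f a) else 0) = 0"
    using eqs adj_irrefl[of a] adj_irrefl[of b] adj_sym[of a b] adj_sym[of b a]
    unfolding split X_def by (auto simp: add.commute split: if_splits)
  moreover have "(s + t) * (f a - f b) = (X a + (if A a b then z b * (f a - f b) else 0)) -
      (X b + (if A a b then z a * (f b - f a) else 0))"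
    unfolding distrib_right diff by (simp add: t_def algebra_simps)
  ultimately have "(s + t) * (f a - f b) = 0" by simp
  \<comment> \<open>Connectedness gives \<open>a\<close> a neighbour; without one,
    \<open>s + t\<close> would be \<open>0\<close>.\<close>
  moreover have "0 < Im (s + t)"
  proof -
    have ims: "Im s = (\<Sum>w\<in>V'. if A a w then Im (z w) else 0)"
      unfolding s_def Im_sum by (intro sum.cong) auto
    have pos: "0 \<le> (if A a w then Im (z w) else 0)" if "w \<in> V'" for w
      using z that by (auto simp: V'_def less_imp_le)
    have zab: "0 < Im (z a)" "0 < Im (z b)" using z ab by auto
    obtain w where w: "w \<in> V" "A a w" using conn_neighbour[OF V(2) ab] by blast
    show ?thesis
    proof (cases "w = b")
      case True
      moreover have "0 \<le> Im s" unfolding ims by (rule sum_nonneg) (rule pos)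
      ultimately show ?thesis using zab w by (auto simp: t_def)
    next
      case False
      then have w': "w \<in> V'" using w adj_irrefl by (auto simp: V'_def)
      have "0 < (\<Sum>w\<in>V'. if A a w then Im (z w) else 0)"
        by (rule sum_pos2[OF V' w']) (use pos w z in auto)
      then show ?thesis using zab ims by (auto simp: t_def)
    qed
  qed
  then have "s + t \<noteq> 0" by (metis less_irrefl zero_complex.simps(2))
  ultimately have fab: "f a = f b" by simp
  define z' where "z' = z(a := z a + z b)"
  have harm': "harmonic (V - {b}) z' f"
    unfolding harmonic_def
  proof
    fix x assume x: "x \<in> V - {b}"
    have "V - {b} = insert a V'" "a \<notin> V'" using ab by (auto simp: V'_def)
    then have "(\<Sum>w\<in>V - {b}. if A x w then z' w * (f x - f w) else 0) =
        (if A x a then z' a * (f x - f a) else 0) + (\<Sum>w\<in>V'. if A x w then z' w * (f x - f w) else 0)"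
      by (simp only: sum.insert[OF V'] not_False_eq_True if_True)
    also have "(\<Sum>w\<in>V'. if A x w then z' w * (f x - f w) else 0) =
        (\<Sum>w\<in>V'. if A x w then z w * (f x - f w) else 0)"
      by (intro sum.cong) (auto simp: z'_def V'_def)
    also have "(if A x a then z' a * (f x - f a) else 0) =
       (if A x a then z a * (f x - f a) else 0) + (if A x b then z b * (f x - f b) else 0)"
    proof (cases "x = a")
      case True
      then show ?thesis using fab by simp
    next
      case False
      then have "A x a \<longleftrightarrow> A x b" using twins[of x] x adj_sym by blast
      then show ?thesis using fab by (simp add: z'_def algebra_simps)
    qed
    finally show "(\<Sum>w\<in>V - {b}. if A x w then z' w * (f x - f w) else 0) = 0"
      using harm x unfolding harmonic_def split by auto
  qed
  have pos': "0 < Im (z' x)" if "x \<in> V - {b}" for x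
  proof (cases "x = a")
    case True
    moreover have "0 < Im (z a)" "0 < Im (z b)" using z ab by blast+
    ultimately show ?thesis by (simp add: z'_def)
  next
    case False
    then show ?thesis using z that by (simp add: z'_def)
  qed
  have const: "f x = f a" if "x \<in> V" for x
  proof (cases "x = b")
    case False
    show ?thesis by (rule rigidD[OF rigid _ harm']) (use that False pos' ab in simp_all)
  qed (simp add: fab)
  show "\<forall>u\<in>V. \<forall>v\<in>V. f u = f v"
    by (intro ballI) (rule trans[OF const const[symmetric]])
qed

theorem dist_hered_imp_rigid:
  assumes "finite V" "conn V" "dist_hered V"
  shows "rigid V"
  using assms
proof (induction "card V" arbitrary: V rule: less_induct)
  case less
  have smaller: "rigid (V - {v})"
    if "v \<in> V" "u \<in> V" "u \<noteq> v" "\<And>x. x \<in> V - {u, v} \<Longrightarrow> A v x \<Longrightarrow> A u x" for u v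
  proof -
    have "conn (V - {v})" using conn_Diff_dominated less that by blast
    moreover have "card (V - {v}) < card V" by (rule card_Diff1_less[OF less(2) that(1)])
    ultimately show ?thesis
      using less(1)[of "V - {v}"] less(2-4) dist_hered_subset[OF less(4)] by blast
  qed
  show ?case
  proof (cases "card V \<ge> 2")
    case True
    then consider v u where "v \<in> V" "u \<in> V" "u \<noteq> v" "\<forall>x\<in>V. A v x \<longleftrightarrow> x = u"
      | a b where "a \<in> V" "b \<in> V" "a \<noteq> b" "\<forall>x\<in>V - {a, b}. A a x \<longleftrightarrow> A b x"
      using dist_hered_pendant_or_twins[OF less(2-4)] by blast
    then show ?thesis
    proof cases
      case 1
      then have "rigid (V - {v})" by (intro smaller[of v u]) auto
      then show ?thesis using rigid_pendant[OF less(2)] 1 by blast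
    next
      case 2
      then have "rigid (V - {b})" by (intro smaller[of b a]) auto
      then show ?thesis using rigid_twins[OF less(2,3)] 2 by blast
    qed
  next
    case False
    then have "u = v" if "u \<in> V" "v \<in> V" for u v
      using that card_le_Suc0_iff_eq[OF less(2)] by auto
    then show ?thesis unfolding rigid_def by metis
  qed
qed

end

section \<open>The matrix-tree theorem\<close>

text \<open>The determinant is kept as its Leibniz sum, because the matrix-tree argument expands the
  products under the sum over permutations.\<close>

lemma sum_permutes_eq_0_iff:
  fixes M :: "nat \<Rightarrow> nat \<Rightarrow> 'b :: field"
  shows "(\<Sum>\<pi> | \<pi> permutes {0..<n}. signof \<pi> * (\<Prod>i = 0..<n. M i (\<pi> i))) = 0 \<longleftrightarrow>
    (\<exists>x. (\<exists>i<n. x i \<noteq> 0) \<and> (\<forall>i<n. (\<Sum>j = 0..<n. M i j * x j) = 0))"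
    (is "?l = 0 \<longleftrightarrow> _")
proof -
  define B where "B = mat n n (\<lambda>(i, j). M i j)"
  have B: "B \<in> carrier_mat n n" by (simp add: B_def)
  have "?l = Determinant.det B"
    unfolding det_def'[OF B]
    by (intro sum.cong arg_cong2[where f = "(*)"] prod.cong) (auto simp: B_def)
  then have "?l = 0 \<longleftrightarrow> (\<exists>v. v \<in> carrier_vec n \<and> v \<noteq> 0\<^sub>v n \<and> B *\<^sub>v v = 0\<^sub>v n)"
    using det_0_iff_vec_prod_zero_field[OF B] by simp
  also have "\<dots> \<longleftrightarrow> (\<exists>x. (\<exists>i<n. x i \<noteq> 0) \<and> (\<forall>i<n. (\<Sum>j = 0..<n. M i j * x j) = 0))"
    (is "_ \<longleftrightarrow> ?r")
  proof
    assume "\<exists>v. v \<in> carrier_vec n \<and> v \<noteq> 0\<^sub>v n \<and> B *\<^sub>v v = 0\<^sub>v n"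
    then obtain v where v: "v \<in> carrier_vec n" "v \<noteq> 0\<^sub>v n" and Bv: "B *\<^sub>v v = 0\<^sub>v n" by blast
    have "\<exists>i<n. v $ i \<noteq> 0"
      using v by (metis carrier_vecD eq_vecI index_zero_vec)
    moreover have "(\<Sum>j = 0..<n. M i j * v $ j) = 0" if "i < n" for i
    proof -
      have "(B *\<^sub>v v) $ i = 0" using Bv that by simp
      then show ?thesis using that v by (simp add: B_def scalar_prod_def)
    qed
    ultimately show ?r by blast
  next
    assume ?r
    then obtain x where x: "\<exists>i<n. x i \<noteq> 0" "\<forall>i<n. (\<Sum>j = 0..<n. M i j * x j) = 0" by blast
    have "vec n x \<noteq> 0\<^sub>v n" using x(1) by (metis index_vec index_zero_vec(1))
    moreover have "B *\<^sub>v vec n x = 0\<^sub>v n"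
      using x(2) by (intro eq_vecI) (auto simp: B_def scalar_prod_def)
    ultimately show "\<exists>v. v \<in> carrier_vec n \<and> v \<noteq> 0\<^sub>v n \<and> B *\<^sub>v v = 0\<^sub>v n"
      by (intro exI[of _ "vec n x"]) simp
  qed
  finally show ?thesis .
qed

text \<open>
  The determinant of the identity matrix minus the adjacency matrix of the functional graph of
  \<open>P\<close> on \<open>e ` {0..<n}\<close> is \<open>1\<close> or \<open>0\<close>, according to whether iterating \<open>P\<close> always leads to \<open>r\<close>.
\<close>

lemma sum_permutes_parent:
  fixes e :: "nat \<Rightarrow> 'a" and P :: "'a \<Rightarrow> 'a"
  assumes e: "bij_betw e {0..<n} S" and r: "r \<notin> S" and P: "\<And>v. v \<in> S \<Longrightarrow> P v \<in> insert r S"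
  shows "(\<Sum>\<pi> | \<pi> permutes {0..<n}. signof \<pi> *
      (\<Prod>i = 0..<n. (if i = \<pi> i then 1 else 0) - (if P (e i) = e (\<pi> i) then 1 else 0))) =
    (if \<exists>d :: 'a \<Rightarrow> nat. \<forall>v\<in>S. d (P v) < d v then 1 else (0 :: 'b :: field))"
proof -
  have eS: "e i \<in> S" if "i < n" for i using e that by (auto simp: bij_betw_def)
  have inj: "e i = e j \<longleftrightarrow> i = j" if "i < n" "j < n" for i j
    using e that by (auto simp: bij_betw_def inj_on_def)
  let ?c = "\<lambda>i j. (if i = j then 1 else 0) - (if P (e i) = e j then 1 else (0 :: 'b))"
  show ?thesis
  proof (cases "\<exists>d :: 'a \<Rightarrow> nat. \<forall>v\<in>S. d (P v) < d v")
    case True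
    then obtain d :: "'a \<Rightarrow> nat" where d: "\<And>v. v \<in> S \<Longrightarrow> d (P v) < d v" by blast
    \<comment> \<open>A permutation with nonzero product follows \<open>P\<close> at each index that
      it moves, and so lowers \<open>d\<close> there. At a moved index with least \<open>d\<close>
      this is impossible, as its image is moved as well.\<close>
    have zero: "(\<Prod>i = 0..<n. ?c i (\<pi> i)) = 0" if \<pi>: "\<pi> permutes {0..<n}" "\<pi> \<noteq> id" for \<pi>
    proof (rule ccontr)
      assume "(\<Prod>i = 0..<n. ?c i (\<pi> i)) \<noteq> 0"
      then have nz: "?c i (\<pi> i) \<noteq> 0" if "i < n" for i using that by auto
      have pn: "\<pi> i < n" if "i < n" for i using permutes_in_image[OF \<pi>(1), of i] that by simp
      obtain i0 where "\<pi> i0 \<noteq> i0" using \<pi>(2) by (auto simp: fun_eq_iff)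
      then have "i0 < n \<and> \<pi> i0 \<noteq> i0" using permutes_not_in[OF \<pi>(1), of i0] by force
      then obtain i where i: "i < n" "\<pi> i \<noteq> i"
        and min: "\<And>j. j < n \<Longrightarrow> \<pi> j \<noteq> j \<Longrightarrow> d (e i) \<le> d (e j)"
        using arg_min_nat_lemma[of "\<lambda>i. i < n \<and> \<pi> i \<noteq> i" i0 "\<lambda>i. d (e i)"] by blast
      have "P (e i) = e (\<pi> i)" using nz[OF i(1)] i(2) by (auto split: if_splits)
      then have "d (e (\<pi> i)) < d (e i)" using d[OF eS[OF i(1)]] by simp
      moreover have "\<pi> (\<pi> i) \<noteq> \<pi> i" using i permutes_inj[OF \<pi>(1)] by (auto dest: injD)
      ultimately show False using min[of "\<pi> i"] pn[OF i(1)] by simp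
    qed
    have "(\<Sum>\<pi> | \<pi> permutes {0..<n}. signof \<pi> * (\<Prod>i = 0..<n. ?c i (\<pi> i))) =
      (\<Sum>\<pi>\<in>{id}. signof \<pi> * (\<Prod>i = 0..<n. ?c i (\<pi> i)))"
      by (intro sum.mono_neutral_right) (use zero in \<open>auto simp: finite_permutations permutes_id\<close>)
    also have "\<dots> = (\<Prod>i = 0..<n. ?c i i)" by simp
    also have "\<dots> = 1" by (intro prod.neutral) (use d eS in \<open>fastforce\<close>)
    finally show ?thesis using True by simp
  next
    case False
    define Q where "Q v u \<longleftrightarrow> v \<in> S \<and> u = P v" for v u
    have Q_iff: "Q\<^sup>*\<^sup>* v r \<longleftrightarrow> Q\<^sup>*\<^sup>* (P v) r" if "v \<in> S" for v
    proof
      assume "Q\<^sup>*\<^sup>* v r"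
      then show "Q\<^sup>*\<^sup>* (P v) r"
        by (cases rule: converse_rtranclpE) (use that r in \<open>auto simp: Q_def\<close>)
    next
      assume "Q\<^sup>*\<^sup>* (P v) r"
      then show "Q\<^sup>*\<^sup>* v r"
        using that by (meson Q_def converse_rtranclp_into_rtranclp)
    qed
    have "\<exists>v\<in>S. \<not> Q\<^sup>*\<^sup>* v r"
    proof (rule ccontr)
      assume "\<not> (\<exists>v\<in>S. \<not> Q\<^sup>*\<^sup>* v r)"
      then have reach: "Q\<^sup>*\<^sup>* v r" if "v \<in> S" for v using that by blast
      define d where "d v = (LEAST k. (Q ^^ k) v r)" for v
      have "d (P v) < d v" if v: "v \<in> S" for v
      proof -
        obtain k where "(Q ^^ k) v r" using reach[OF v] rtranclp_imp_relpowp by metis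
        then have dv: "(Q ^^ d v) v r" unfolding d_def by (rule LeastI)
        then obtain m where m: "d v = Suc m" using v r by (cases "d v") auto
        then obtain u where "Q v u" "(Q ^^ m) u r" using dv relpowp_Suc_D2 by metis
        then have "d (P v) \<le> m" unfolding d_def Q_def by (auto intro: Least_le)
        then show ?thesis using m by simp
      qed
      then show False using False by blast
    qed
    then obtain i0 where i0: "i0 < n" "\<not> Q\<^sup>*\<^sup>* (e i0) r"
      using e by (auto simp: bij_betw_def)
    \<comment> \<open>A kernel vector: the indicator of the vertices from which \<open>r\<close> is
      not reached. By \<open>Q_iff\<close> a vertex has this property iff its parent has it.\<close>
    define x where "x i = (if Q\<^sup>*\<^sup>* (e i) r then 0 else 1 :: 'b)" for i
    have "(\<Sum>j = 0..<n. ?c i j * x j) = 0" if i: "i < n" for i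
    proof -
      have "(\<Sum>j = 0..<n. ?c i j * x j) =
        (\<Sum>j = 0..<n. if i = j then x j else 0) - (\<Sum>j = 0..<n. if P (e i) = e j then x j else 0)"
        unfolding sum_subtractf[symmetric] by (intro sum.cong) auto
      also have "(\<Sum>j = 0..<n. if i = j then x j else 0) = x i" using i by simp
      also have "(\<Sum>j = 0..<n. if P (e i) = e j then x j else 0) = x i"
      proof (cases "P (e i) = r")
        case True
        then have "(\<Sum>j = 0..<n. if P (e i) = e j then x j else 0) = 0"
          using r eS by (intro sum.neutral) auto
        moreover have "x i = 0" using Q_iff[OF eS[OF i]] True by (simp add: x_def)
        ultimately show ?thesis by simp
      next
        case False
        then obtain k where k: "k < n" "P (e i) = e k"
          using P[OF eS[OF i]] e by (auto simp: bij_betw_def)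
        then have "(\<Sum>j = 0..<n. if P (e i) = e j then x j else 0) =
            (\<Sum>j = 0..<n. if k = j then x j else 0)"
          using inj by (intro sum.cong) auto
        then show ?thesis using k Q_iff[OF eS[OF i]] by (simp add: x_def)
      qed
      finally show ?thesis by simp
    qed
    moreover have "\<exists>i<n. x i \<noteq> 0" using i0 by (auto simp: x_def)
    ultimately have "\<exists>x. (\<exists>i<n. x i \<noteq> 0) \<and> (\<forall>i<n. (\<Sum>j = 0..<n. ?c i j * x j) = 0)"
      by (intro exI[of _ x]) simp
    then have "(\<Sum>\<pi> | \<pi> permutes {0..<n}. signof \<pi> * (\<Prod>i = 0..<n. ?c i (\<pi> i))) = 0"
      unfolding sum_permutes_eq_0_iff[where M = ?c] .
    then show ?thesis unfolding if_not_P[OF False] .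
  qed
qed

context adjacency
begin

text \<open>Spanning trees oriented towards \<open>r\<close>, where \<open>P v\<close> is the parent
  of \<open>v\<close>. The function decreasing along \<open>P\<close> expresses acyclicity and
  serves as an induction measure.\<close>

definition arborescences :: "'a set \<Rightarrow> 'a \<Rightarrow> ('a \<Rightarrow> 'a) set" where
  "arborescences V r = {P \<in> (\<Pi>\<^sub>E v\<in>V - {r}. {u \<in> V. A v u}).
     \<exists>d :: 'a \<Rightarrow> nat. \<forall>v\<in>V - {r}. d (P v) < d v}"

definition tree_sum :: "'a set \<Rightarrow> 'a \<Rightarrow> ('a \<Rightarrow> 'b :: comm_ring_1) \<Rightarrow> 'b" where
  "tree_sum V r z = (\<Sum>P\<in>arborescences V r. \<Prod>v\<in>V - {r}. z (P v))"

text \<open>Row \<open>v\<close> of the reduced Laplacian is a sum over the neighbours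
  \<open>u\<close> of \<open>v\<close>. By multilinearity its determinant is a sum over all choices
  \<open>P\<close> of one neighbour per row, and by \<open>sum_permutes_parent\<close> exactly the
  arborescences survive, each with coefficient 1.\<close>

theorem tree_sum_eq_0_iff:
  fixes z :: "'a \<Rightarrow> 'b :: field"
  assumes V: "finite V" "r \<in> V"
  shows "tree_sum V r z = 0 \<longleftrightarrow> (\<exists>f. f r = 0 \<and> (\<exists>v\<in>V. f v \<noteq> 0) \<and>
    (\<forall>v\<in>V - {r}. (\<Sum>w\<in>V. if A v w then z w * (f v - f w) else 0) = 0))"
proof -
  define S where "S = V - {r}"
  define N where "N v = {u \<in> V. A v u}" for v
  have fin: "finite S" "\<And>v. finite (N v)" using V by (auto simp: S_def N_def)
  have VS: "V = insert r S" "r \<notin> S" using V by (auto simp: S_def)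
  obtain e where e: "bij_betw e {0..<card S} S"
    using ex_bij_betw_nat_finite[OF fin(1)] by blast
  define n where "n = card S"
  have e: "bij_betw e {0..<n} S" using e by (simp add: n_def)
  have eS: "e i \<in> S" if "i < n" for i using e that by (auto simp: bij_betw_def)
  have inj: "e i = e j \<longleftrightarrow> i = j" if "i < n" "j < n" for i j
    using e that by (auto simp: bij_betw_def inj_on_def)
  define c :: "'a \<Rightarrow> 'a \<Rightarrow> 'a \<Rightarrow> 'b"
    where "c v u w = (if v = w then 1 else 0) - (if u = w then 1 else 0)" for v u w
  define M where "M i j = (\<Sum>u\<in>N (e i). z u * c (e i) u (e j))" for i j
  have "(\<Sum>\<pi> | \<pi> permutes {0..<n}. signof \<pi> * (\<Prod>i = 0..<n. M i (\<pi> i))) =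
    (\<Sum>\<pi> | \<pi> permutes {0..<n}. signof \<pi> *
      (\<Sum>P\<in>Pi\<^sub>E S N. \<Prod>i = 0..<n. z (P (e i)) * c (e i) (P (e i)) (e (\<pi> i))))"
  proof (intro sum.cong refl arg_cong2[where f = "(*)"])
    fix \<pi> assume "\<pi> \<in> {\<pi>. \<pi> permutes {0..<n}}"
    define g where "g v = e (\<pi> (inv_into {0..<n} e v))" for v
    have g: "g (e i) = e (\<pi> i)" if "i < n" for i
      using e that by (simp add: g_def bij_betw_def)
    have "(\<Prod>i = 0..<n. M i (\<pi> i)) = (\<Prod>i = 0..<n. \<Sum>u\<in>N (e i). z u * c (e i) u (g (e i)))"
      by (intro prod.cong) (auto simp: M_def g)
    also have "\<dots> = (\<Prod>v\<in>S. \<Sum>u\<in>N v. z u * c v u (g v))"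
      by (rule prod.reindex_bij_betw[OF e])
    also have "\<dots> = (\<Sum>P\<in>Pi\<^sub>E S N. \<Prod>v\<in>S. z (P v) * c v (P v) (g v))"
      by (rule prod_sum_PiE) (use fin in auto)
    also have "\<dots> = (\<Sum>P\<in>Pi\<^sub>E S N. \<Prod>i = 0..<n. z (P (e i)) * c (e i) (P (e i)) (g (e i)))"
      by (intro sum.cong refl prod.reindex_bij_betw[OF e, symmetric])
    also have "\<dots> = (\<Sum>P\<in>Pi\<^sub>E S N. \<Prod>i = 0..<n. z (P (e i)) * c (e i) (P (e i)) (e (\<pi> i)))"
      by (intro sum.cong prod.cong) (auto simp: g)
    finally show "(\<Prod>i = 0..<n. M i (\<pi> i)) = \<dots>" .
  qed
  also have "\<dots> = (\<Sum>P\<in>Pi\<^sub>E S N. \<Sum>\<pi> | \<pi> permutes {0..<n}. signof \<pi> *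
      (\<Prod>i = 0..<n. z (P (e i)) * c (e i) (P (e i)) (e (\<pi> i))))"
    unfolding sum_distrib_left by (rule sum.swap)
  also have "\<dots> = (\<Sum>P\<in>Pi\<^sub>E S N.
    if \<exists>d :: 'a \<Rightarrow> nat. \<forall>v\<in>S. d (P v) < d v then \<Prod>v\<in>S. z (P v) else 0)"
  proof (intro sum.cong refl)
    fix P assume P: "P \<in> Pi\<^sub>E S N"
    have PV: "P v \<in> insert r S" if "v \<in> S" for v
      using P that VS by (auto simp: N_def PiE_iff)
    have "(\<Sum>\<pi> | \<pi> permutes {0..<n}. signof \<pi> *
        (\<Prod>i = 0..<n. z (P (e i)) * c (e i) (P (e i)) (e (\<pi> i)))) =
      (\<Prod>i = 0..<n. z (P (e i))) * (\<Sum>\<pi> | \<pi> permutes {0..<n}. signof \<pi> *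
      (\<Prod>i = 0..<n. (if i = \<pi> i then 1 else 0) - (if P (e i) = e (\<pi> i) then 1 else 0)))"
      unfolding sum_distrib_left
    proof (intro sum.cong refl)
      fix \<pi> assume "\<pi> \<in> {\<pi>. \<pi> permutes {0..<n}}"
      then have "\<pi> i < n" if "i < n" for i using permutes_in_image[of \<pi> "{0..<n}" i] that by simp
      then have "(\<Prod>i = 0..<n. c (e i) (P (e i)) (e (\<pi> i))) =
          (\<Prod>i = 0..<n. (if i = \<pi> i then 1 else 0) - (if P (e i) = e (\<pi> i) then 1 else 0))"
        by (intro prod.cong) (auto simp: c_def inj)
      then show "signof \<pi> * (\<Prod>i = 0..<n. z (P (e i)) * c (e i) (P (e i)) (e (\<pi> i))) =
        (\<Prod>i = 0..<n. z (P (e i))) * (signof \<pi> *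
        (\<Prod>i = 0..<n. (if i = \<pi> i then 1 else 0) - (if P (e i) = e (\<pi> i) then 1 else 0)))"
        by (simp add: prod.distrib mult_ac)
    qed
    also have "\<dots> = (if \<exists>d :: 'a \<Rightarrow> nat. \<forall>v\<in>S. d (P v) < d v then \<Prod>v\<in>S. z (P v) else 0)"
      by (subst sum_permutes_parent[OF e VS(2) PV], assumption,
          cases "\<exists>d :: 'a \<Rightarrow> nat. \<forall>v\<in>S. d (P v) < d v")
         (simp_all only: if_True if_False mult_1_right mult_zero_right
            prod.reindex_bij_betw[OF e, of "\<lambda>v. z (P v)"])
    finally show "(\<Sum>\<pi> | \<pi> permutes {0..<n}. signof \<pi> *
        (\<Prod>i = 0..<n. z (P (e i)) * c (e i) (P (e i)) (e (\<pi> i)))) = \<dots>" .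
  qed
  also have "\<dots> = tree_sum V r z"
    unfolding tree_sum_def arborescences_def S_def[symmetric] N_def[symmetric]
    by (rule sum.inter_filter[symmetric]) (use fin in \<open>auto intro!: finite_PiE\<close>)
  finally have "tree_sum V r z = 0 \<longleftrightarrow>
      (\<exists>x. (\<exists>i<n. x i \<noteq> 0) \<and> (\<forall>i<n. (\<Sum>j = 0..<n. M i j * x j) = 0))"
    using sum_permutes_eq_0_iff[where n = n and M = M] by simp
  also have "\<dots> \<longleftrightarrow> (\<exists>f. f r = 0 \<and> (\<exists>v\<in>V. f v \<noteq> 0) \<and>
    (\<forall>v\<in>S. (\<Sum>w\<in>V. if A v w then z w * (f v - f w) else 0) = 0))" (is "?l \<longleftrightarrow> ?r")
  proof -
    \<comment> \<open>The column of \<open>r\<close> is missing in \<open>M\<close>; the condition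
      \<open>f r = 0\<close> makes up for it.\<close>
    have row: "(\<Sum>j = 0..<n. M i j * f (e j)) =
        (\<Sum>w\<in>V. if A (e i) w then z w * (f (e i) - f w) else 0)"
      if i: "i < n" and f: "f r = 0" for i and f :: "'a \<Rightarrow> 'b"
    proof -
      have "(\<Sum>j = 0..<n. M i j * f (e j)) = (\<Sum>w\<in>S. (\<Sum>u\<in>N (e i). z u * c (e i) u w) * f w)"
        unfolding M_def by (rule sum.reindex_bij_betw[OF e])
      also have "\<dots> = (\<Sum>u\<in>N (e i). \<Sum>w\<in>S. z u * c (e i) u w * f w)"
        unfolding sum_distrib_right by (rule sum.swap)
      also have "\<dots> = (\<Sum>u\<in>N (e i). z u * (f (e i) - f u))"
      proof (intro sum.cong refl)
        fix u assume u: "u \<in> N (e i)"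
        have "(\<Sum>w\<in>S. z u * c (e i) u w * f w) =
          z u * ((\<Sum>w\<in>S. if e i = w then f w else 0) - (\<Sum>w\<in>S. if u = w then f w else 0))"
          unfolding sum_subtractf[symmetric] sum_distrib_left
          by (intro sum.cong) (auto simp: c_def algebra_simps)
        also have "(\<Sum>w\<in>S. if e i = w then f w else 0) = f (e i)"
          using fin eS[OF i] by simp
        also have "(\<Sum>w\<in>S. if u = w then f w else 0) = f u"
          using fin u f VS by (auto simp: N_def)
        finally show "(\<Sum>w\<in>S. z u * c (e i) u w * f w) = z u * (f (e i) - f u)" .
      qed
      also have "\<dots> = (\<Sum>w\<in>V. if A (e i) w then z w * (f (e i) - f w) else 0)"
        unfolding N_def using V by (simp add: sum.inter_filter)
      finally show ?thesis .
    qed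
    show ?thesis
    proof
      assume ?l
      then obtain x where x: "\<exists>i<n. x i \<noteq> 0" "\<forall>i<n. (\<Sum>j = 0..<n. M i j * x j) = 0" by blast
      define f where "f v = (if v = r then 0 else x (inv_into {0..<n} e v))" for v
      have f: "f (e i) = x i" if "i < n" for i
        using e that eS VS by (auto simp: f_def bij_betw_def)
      have fr: "f r = 0" by (simp add: f_def)
      have "(\<Sum>w\<in>V. if A v w then z w * (f v - f w) else 0) = 0" if v: "v \<in> S" for v
      proof -
        obtain i where i: "i < n" "v = e i" using e v by (auto simp: bij_betw_def)
        have "(\<Sum>j = 0..<n. M i j * f (e j)) = 0" using x(2) i(1) f by simp
        then show ?thesis unfolding row[OF i(1), of f, OF fr] i(2) .
      qed
      moreover have "\<exists>v\<in>V. f v \<noteq> 0" using x(1) f eS VS by (metis insertCI)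
      ultimately show ?r using fr by blast
    next
      assume ?r
      then obtain f where f: "f r = 0" "\<exists>v\<in>V. f v \<noteq> 0"
        "\<forall>v\<in>S. (\<Sum>w\<in>V. if A v w then z w * (f v - f w) else 0) = 0" by blast
      then obtain v where "v \<in> S" "f v \<noteq> 0" using VS by auto
      then obtain i where "i < n" "f (e i) \<noteq> 0" using e by (auto simp: bij_betw_def)
      moreover have "(\<Sum>j = 0..<n. M i j * f (e j)) = 0" if "i < n" for i
        using f(3) eS[OF that] row[OF that, of f, OF f(1)] by simp
      ultimately show ?l by (intro exI[of _ "\<lambda>i. f (e i)"]) blast
    qed
  qed
  finally show ?thesis by (simp add: S_def)
qed

end

section \<open>Rigidity of connected induced subgraphs\<close>

context adjacency
begin

lemma finite_arborescences: "finite V \<Longrightarrow> finite (arborescences V r)"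
  unfolding arborescences_def by (rule finite_subset[OF _ finite_PiE[of "V - {r}" "\<lambda>v. {u \<in> V. A v u}"]]) auto

text \<open>The weighted sum of all the equations vanishes identically, so the one at \<open>r\<close> is redundant.\<close>

lemma harmonicI:
  assumes U: "finite U" "r \<in> U" and zr: "z r \<noteq> 0"
    and eq: "\<And>v. v \<in> U - {r} \<Longrightarrow> (\<Sum>w\<in>U. if A v w then z w * (f v - f w) else 0) = 0"
  shows "harmonic U z f"
proof -
  define h where "h v = (\<Sum>w\<in>U. if A v w then z w * (f v - f w) else 0)" for v
  define k where "k v w = (if A v w then z v * z w * (f v - f w) else 0)" for v w
  have anti: "k w v = - k v w" for v w
    using adj_sym[of v w] adj_sym[of w v] by (auto simp: k_def algebra_simps)
  have zero: "x = 0" if "x = - x" for x :: complex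
    using that by (simp add: complex_eq_iff)
  have "(\<Sum>v\<in>U. \<Sum>w\<in>U. k v w) = (\<Sum>v\<in>U. \<Sum>w\<in>U. - k v w)"
    by (subst sum.swap, intro sum.cong refl anti)
  also have "\<dots> = - (\<Sum>v\<in>U. \<Sum>w\<in>U. k v w)"
    unfolding sum_negf ..
  finally have "(\<Sum>v\<in>U. \<Sum>w\<in>U. k v w) = 0" by (rule zero)
  moreover have "(\<Sum>v\<in>U. z v * h v) = (\<Sum>v\<in>U. \<Sum>w\<in>U. k v w)"
    unfolding h_def k_def sum_distrib_left by (intro sum.cong) auto
  ultimately have "(\<Sum>v\<in>U. z v * h v) = 0" by simp
  moreover have "(\<Sum>v\<in>U. z v * h v) = z r * h r + (\<Sum>v\<in>U - {r}. z v * h v)"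
    by (rule sum.remove[OF U])
  moreover have "(\<Sum>v\<in>U - {r}. z v * h v) = 0"
    by (intro sum.neutral) (use eq in \<open>simp add: h_def\<close>)
  ultimately have "h r = 0" using zr by simp
  then show ?thesis using eq unfolding harmonic_def h_def by blast
qed

lemma rigid_iff_tree_sum:
  assumes U: "finite U" "r \<in> U"
  shows "rigid U \<longleftrightarrow> (\<forall>z. (\<forall>v\<in>U. 0 < Im (z v)) \<longrightarrow> tree_sum U r z \<noteq> 0)"
proof
  assume rigid: "rigid U"
  show "\<forall>z. (\<forall>v\<in>U. 0 < Im (z v)) \<longrightarrow> tree_sum U r z \<noteq> 0"
  proof (intro allI impI notI)
    fix z assume z: "\<forall>v\<in>U. 0 < Im (z v)" and "tree_sum U r z = 0"
    then obtain f where f: "f r = 0" "\<exists>v\<in>U. f v \<noteq> 0"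
      "\<forall>v\<in>U - {r}. (\<Sum>w\<in>U. if A v w then z w * (f v - f w) else 0) = 0"
      using tree_sum_eq_0_iff[OF U, of z] by blast
    have "z r \<noteq> 0" using z U by force
    then have "harmonic U z f" using harmonicI[OF U] f by blast
    then have "f v = f r" if "v \<in> U" for v using rigidD[OF rigid] z that U by blast
    then show False using f by simp
  qed
next
  assume nz: "\<forall>z. (\<forall>v\<in>U. 0 < Im (z v)) \<longrightarrow> tree_sum U r z \<noteq> 0"
  show "rigid U"
    unfolding rigid_def
  proof (intro allI impI)
    fix z f assume z: "\<forall>v\<in>U. 0 < Im (z v)" and harm: "harmonic U z f"
    \<comment> \<open>The equations see only differences, so \<open>f\<close> may be shifted to
      vanish at \<open>r\<close>.\<close>
    define g where "g v = f v - f r" for v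
    have diff: "g v - g w = f v - f w" for v w by (simp add: g_def)
    have "(\<Sum>w\<in>U. if A v w then z w * (g v - g w) else 0) = 0" if "v \<in> U" for v
      using bspec[OF harm[unfolded harmonic_def] that] unfolding diff .
    moreover have "g r = 0" by (simp add: g_def)
    ultimately have "g v = 0" if "v \<in> U" for v
      using nz z tree_sum_eq_0_iff[OF U, of z] that by blast
    then have const: "f v = f r" if "v \<in> U" for v using that by (simp add: g_def)
    show "\<forall>u\<in>U. \<forall>v\<in>U. f u = f v"
      by (intro ballI) (rule trans[OF const const[symmetric]])
  qed
qed

lemma conn_insert:
  assumes "conn U" "u \<in> U" "A v u"
  shows "conn (insert v U)"
proof (rule connI)
  fix t assume "t \<in> insert v U"
  moreover have "(rel_on (insert v U))\<^sup>*\<^sup>* v u" using assms by (auto simp: rel_on_def)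
  moreover have "(rel_on (insert v U))\<^sup>*\<^sup>* t u" if "t \<in> U"
    by (rule rel_on_reach_mono[OF connD[OF assms(1) that assms(2)]]) auto
  ultimately show "(rel_on (insert v U))\<^sup>*\<^sup>* t u" by blast
qed

text \<open>A breadth-first tree of \<open>U\<close> with \<open>v\<close> attached as a leaf at
  \<open>u\<close>. It shows that the tree sum with weight \<open>1\<close> on \<open>U\<close> and
  \<open>0\<close> at \<open>v\<close>, which counts the trees where \<open>v\<close> has no
  children, is not zero.\<close>

lemma arborescence_leaf:
  assumes U: "conn U" "r \<in> U" and v: "v \<notin> U" "u \<in> U" "A v u"
  shows "\<exists>P\<in>arborescences (insert v U) r. \<forall>x\<in>insert v U - {r}. P x \<in> U"
proof -
  define par where "par x = (SOME w. w \<in> U \<and> A x w \<and> Suc (dst U w r) = dst U x r)" for x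
  have par: "par x \<in> U \<and> A x (par x) \<and> Suc (dst U (par x) r) = dst U x r"
    if x: "x \<in> U" "x \<noteq> r" for x
  proof -
    obtain k where k: "dst U x r = Suc k" using dst_eq_0[OF U(1) x(1) U(2)] x(2) by (cases "dst U x r") auto
    obtain w where "w \<in> U" "A x w" "dst U w r = k" by (rule dst_SucE[OF U(1) x(1) U(2) k])
    then have "\<exists>w. w \<in> U \<and> A x w \<and> Suc (dst U w r) = dst U x r" using k by auto
    then show ?thesis unfolding par_def by (rule someI_ex)
  qed
  define P where "P = (\<lambda>x\<in>insert v U - {r}. if x = v then u else par x)"
  define d where "d x = (if x = v then Suc (dst U u r) else dst U x r)" for x
  have PU: "P x \<in> U" "A x (P x)" "d (P x) < d x" if "x \<in> insert v U - {r}" for x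
  proof -
    have "P x \<in> U \<and> A x (P x) \<and> d (P x) < d x"
    proof (cases "x = v")
      case True
      then show ?thesis using that v U by (auto simp: P_def d_def)
    next
      case False
      then have x: "x \<in> U" "x \<noteq> r" using that by auto
      then show ?thesis using par[OF x] False v that by (auto simp: P_def d_def)
    qed
    then show "P x \<in> U" "A x (P x)" "d (P x) < d x" by auto
  qed
  have "P \<in> extensional (insert v U - {r})" unfolding P_def by simp
  then have "P \<in> (\<Pi>\<^sub>E x\<in>insert v U - {r}. {w \<in> insert v U. A x w})"
    using PU(1,2) unfolding PiE_iff by blast
  then have "P \<in> arborescences (insert v U) r"
    unfolding arborescences_def using PU(3) by blast
  then show ?thesis using PU(1) by blast
qed

text \<open>
  A zero of the tree sum of \<open>U\<close> gives a zero of the tree sum of \<open>insert v U\<close> whose coordinate at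
  \<open>v\<close> is \<open>0\<close>. Hurwitz' theorem moves the latter into the upper half-plane; it is applied on the line
  through this zero and the point with all coordinates \<open>1\<close> (but \<open>0\<close> at \<open>v\<close>), where the tree sum
  counts trees.
\<close>

lemma rigid_insertD:
  assumes U: "finite U" "conn U" and v: "v \<notin> U" "u \<in> U" "A v u" and rigid: "rigid (insert v U)"
  shows "rigid U"
proof (rule ccontr)
  assume "\<not> rigid U"
  define r where "r = u"
  have r: "r \<in> U" using v by (simp add: r_def)
  obtain z where z: "\<forall>x\<in>U. 0 < Im (z x)" and "tree_sum U r z = 0"
    using \<open>\<not> rigid U\<close> rigid_iff_tree_sum[OF U(1) r] by blast
  then obtain f where f: "f r = 0" "\<exists>x\<in>U. f x \<noteq> 0"
    and feq: "\<And>x. x \<in> U - {r} \<Longrightarrow> (\<Sum>w\<in>U. if A x w then z w * (f x - f w) else 0) = 0"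
    using tree_sum_eq_0_iff[OF U(1) r, of z] by blast
  define V where "V = insert v U"
  have V: "finite V" "r \<in> V" using U r by (auto simp: V_def)
  have sumV: "(\<Sum>w\<in>V. h w) = h v + (\<Sum>w\<in>U. h w)" for h :: "'a \<Rightarrow> complex"
    using U v by (simp add: V_def)
  \<comment> \<open>\<open>s\<close> is the parameter on the line from \<open>z\<close> to the point
    with all coordinates \<open>1\<close>, and \<open>t\<close> is the weight of
    \<open>v\<close>.\<close>
  define Z where "Z s t x = (if x = v then t else z x + s * (1 - z x))" for s t x
  define F where "F s t = tree_sum V r (Z s t)" for s t
  have "F 0 0 = 0"
  proof -
    define s where "s = (\<Sum>w\<in>U. if A v w then z w else 0)"
    have "0 < (\<Sum>w\<in>U. if A v w then Im (z w) else 0)"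
      by (rule sum_pos2[OF U(1) v(2)]) (use z v in \<open>auto simp: less_imp_le\<close>)
    moreover have "Im s = (\<Sum>w\<in>U. if A v w then Im (z w) else 0)"
      unfolding s_def Im_sum by (intro sum.cong) auto
    ultimately have s: "s \<noteq> 0" by auto
    \<comment> \<open>The weighted mean of \<open>f\<close> over the neighbours of \<open>v\<close>
      solves the equation at \<open>v\<close>. The other equations do not change, because
      \<open>v\<close> has weight \<open>0\<close>.\<close>
    define m where "m = (\<Sum>w\<in>U. if A v w then z w * f w else 0) / s"
    define f' where "f' = f(v := m)"
    have vr: "v \<noteq> r" using v r by auto
    have f': "f' x = f x" if "x \<in> U" for x using that v by (auto simp: f'_def)
    have Z0: "Z 0 0 x = z x" if "x \<in> U" for x using that v by (auto simp: Z_def)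
    have U_sum: "(\<Sum>w\<in>U. if A x w then Z 0 0 w * (f' x - f' w) else 0) =
        (\<Sum>w\<in>U. if A x w then z w * (f' x - f w) else 0)" for x
      by (intro sum.cong) (auto simp: Z0 f')
    have "(\<Sum>w\<in>V. if A x w then Z 0 0 w * (f' x - f' w) else 0) = 0" if "x \<in> V - {r}" for x
    proof (cases "x = v")
      case True
      have "(\<Sum>w\<in>U. if A v w then z w * (m - f w) else 0) =
          (\<Sum>w\<in>U. m * (if A v w then z w else 0) - (if A v w then z w * f w else 0))"
        by (intro sum.cong) (auto simp: algebra_simps)
      also have "\<dots> = m * s - (\<Sum>w\<in>U. if A v w then z w * f w else 0)"
        unfolding sum_subtractf sum_distrib_left[symmetric] s_def ..
      also have "\<dots> = 0" using s by (simp add: m_def)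
      finally have "(\<Sum>w\<in>U. if A v w then z w * (m - f w) else 0) = 0" .
      moreover have f'v: "f' v = m" by (simp add: f'_def)
      ultimately show ?thesis unfolding True sumV U_sum unfolding f'v by (simp add: adj_irrefl)
    next
      case False
      then have x: "x \<in> U - {r}" using that by (auto simp: V_def)
      then have f'x: "f' x = f x" using f' by blast
      have Zv: "Z 0 0 v = 0" by (simp add: Z_def)
      show ?thesis unfolding sumV U_sum unfolding f'x Zv feq[OF x] by simp
    qed
    moreover have "f' r = 0" "\<exists>x\<in>V. f' x \<noteq> 0"
      using f f' r by (auto simp: V_def)
    ultimately show ?thesis
      unfolding F_def using tree_sum_eq_0_iff[OF V, of "Z 0 0"] by blast
  qed
  have "F 1 0 \<noteq> 0"
  proof -
    define c where "c P = (if \<forall>x\<in>V - {r}. P x \<in> U then 1 else 0 :: nat)" for P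
    have "F 1 0 = (\<Sum>P\<in>arborescences V r. of_nat (c P))"
      unfolding F_def tree_sum_def
    proof (intro sum.cong refl)
      fix P assume "P \<in> arborescences V r"
      then have PV: "P x \<in> V" if "x \<in> V - {r}" for x
        using that by (auto simp: arborescences_def PiE_iff)
      have ZU: "Z 1 0 y = 1" if "y \<in> U" for y using that v by (auto simp: Z_def)
      show "(\<Prod>x\<in>V - {r}. Z 1 0 (P x)) = of_nat (c P)"
      proof (cases "\<forall>x\<in>V - {r}. P x \<in> U")
        case True
        then show ?thesis using ZU by (simp add: c_def)
      next
        case False
        then obtain x where x: "x \<in> V - {r}" "P x \<notin> U" by blast
        then have "Z 1 0 (P x) = 0" using PV[OF x(1)] by (auto simp: Z_def V_def)
        then have "(\<Prod>x\<in>V - {r}. Z 1 0 (P x)) = 0" using x(1) V by (auto intro!: prod_zero)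
        then show ?thesis using False by (simp add: c_def)
      qed
    qed
    also have "\<dots> = of_nat (\<Sum>P\<in>arborescences V r. c P)" by simp
    finally have F1: "F 1 0 = of_nat (\<Sum>P\<in>arborescences V r. c P)" .
    obtain P where "P \<in> arborescences V r" "c P = 1"
      using arborescence_leaf[OF U(2) r v] by (auto simp: V_def c_def)
    then have "(\<Sum>P\<in>arborescences V r. c P) \<noteq> 0"
      using sum_eq_0_iff[OF finite_arborescences[OF V(1)], of c r] by force
    then show ?thesis unfolding F1 of_nat_eq_0_iff .
  qed
  \<comment> \<open>An intersection of half-planes that contains \<open>0\<close> but not
    \<open>1\<close>, where all coordinates are real. So \<open>F 1 0 \<noteq> 0\<close> rules out a
    constant function on \<open>S\<close> only by way of analytic continuation.\<close>
  define S where "S = {s. \<forall>x\<in>U. 0 < Im (z x + s * (1 - z x))}"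
  have S_Int: "S = (\<Inter>x\<in>U. {s. 0 < Im (z x + s * (1 - z x))})" by (auto simp: S_def)
  have "open S"
    unfolding S_Int by (intro open_INT U(1) ballI open_Collect_less continuous_intros)
  have "convex {s. 0 < Im (z x + s * (1 - z x))}" for x
  proof (rule convexI)
    fix s t :: complex and a b :: real
    assume st: "s \<in> {s. 0 < Im (z x + s * (1 - z x))}" "t \<in> {s. 0 < Im (z x + s * (1 - z x))}"
      and ab: "0 \<le> a" "0 \<le> b" "a + b = 1"
    have b: "b = 1 - a" using ab by simp
    have eq: "z x + (a *\<^sub>R s + b *\<^sub>R t) * (1 - z x) =
        a *\<^sub>R (z x + s * (1 - z x)) + b *\<^sub>R (z x + t * (1 - z x))"
      unfolding b by (simp add: scaleR_conv_of_real algebra_simps)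
    have "0 < a * Im (z x + s * (1 - z x)) + b * Im (z x + t * (1 - z x))"
    proof (cases "a = 0")
      case True
      then show ?thesis using st ab by simp
    next
      case False
      then have "0 < a * Im (z x + s * (1 - z x))" using st ab by (intro mult_pos_pos) auto
      moreover have "0 \<le> b * Im (z x + t * (1 - z x))" using st ab by (intro mult_nonneg_nonneg) auto
      ultimately show ?thesis by linarith
    qed
    then have "0 < Im (a *\<^sub>R (z x + s * (1 - z x)) + b *\<^sub>R (z x + t * (1 - z x)))" 
      by (simp only: plus_complex.simps scaleR_complex.simps)
    then show "a *\<^sub>R s + b *\<^sub>R t \<in> {s. 0 < Im (z x + s * (1 - z x))}" unfolding mem_Collect_eq eq .
  qed
  then have "connected S" unfolding S_Int by (intro convex_connected convex_INT)
  have "0 \<in> S" using z by (auto simp: S_def)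
  have holo: "(\<lambda>s. F s t) holomorphic_on X" for t X
    unfolding F_def tree_sum_def Z_def
  proof (intro holomorphic_on_sum holomorphic_on_prod)
    fix P x
    show "(\<lambda>s. if P x = v then t else z (P x) + s * (1 - z (P x))) holomorphic_on X"
      by (cases "P x = v") (auto intro!: holomorphic_intros)
  qed
  have cont: "continuous_on X (\<lambda>p. F (fst p) (snd p))" for X
    unfolding F_def tree_sum_def Z_def
  proof (intro continuous_on_sum continuous_on_prod)
    fix P x
    show "continuous_on X (\<lambda>p. if P x = v then snd p else z (P x) + fst p * (1 - z (P x)))"
      by (cases "P x = v") (auto intro!: continuous_intros)
  qed
  \<comment> \<open>The weights \<open>\<i> / of_nat (Suc n)\<close> of \<open>v\<close> tend to
    \<open>0\<close> from inside the upper half-plane, where rigidity of \<open>insert v U\<close>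
    excludes zeros for \<open>s\<close> in \<open>S\<close>.\<close>
  have "F 0 0 \<noteq> 0"
  proof (rule Hurwitz_no_zeros[OF \<open>open S\<close> \<open>connected S\<close>, of "\<lambda>n s. F s (\<i> / of_nat (Suc n))" "\<lambda>s. F s 0" 0])
    show "uniform_limit K (\<lambda>n s. F s (\<i> / of_nat (Suc n))) (\<lambda>s. F s 0) sequentially"
      if K: "compact K" "K \<subseteq> S" for K
    proof (rule uniform_limitI)
      fix \<epsilon> :: real assume "\<epsilon> > 0"
      have "uniformly_continuous_on (K \<times> cball 0 1) (\<lambda>p. F (fst p) (snd p))"
        using K by (intro compact_uniformly_continuous cont compact_Times compact_cball)
      then obtain \<delta> where \<delta>: "\<delta> > 0" "\<And>p q. p \<in> K \<times> cball 0 1 \<Longrightarrow> q \<in> K \<times> cball 0 1 \<Longrightarrow>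
          dist q p < \<delta> \<Longrightarrow> dist (F (fst q) (snd q)) (F (fst p) (snd p)) < \<epsilon>"
        using \<open>\<epsilon> > 0\<close> unfolding uniformly_continuous_on_def by metis
      have "(\<lambda>n. \<i> / of_nat (Suc n)) \<longlonglongrightarrow> (0 :: complex)"
        using tendsto_mult[OF tendsto_const[of \<i>] LIMSEQ_Suc[OF lim_inverse_n]]
        by (simp add: divide_inverse)
      then have "\<forall>\<^sub>F n in sequentially. dist (\<i> / of_nat (Suc n)) (0 :: complex) < min \<delta> 1"
        using \<delta>(1) by (intro tendstoD) auto
      then show "\<forall>\<^sub>F n in sequentially. \<forall>s\<in>K. dist (F s (\<i> / of_nat (Suc n))) (F s 0) < \<epsilon>"
      proof eventually_elim
        case (elim n)
        show ?case
        proof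
          fix s assume "s \<in> K"
          then show "dist (F s (\<i> / of_nat (Suc n))) (F s 0) < \<epsilon>"
            using \<delta>(2)[of "(s, 0)" "(s, \<i> / of_nat (Suc n))"] elim
            by (simp add: dist_Pair_Pair dist_commute)
        qed
      qed
    qed
    show "\<not> (\<lambda>s. F s 0) constant_on S"
    proof
      assume "(\<lambda>s. F s 0) constant_on S"
      then have "F s 0 = 0" if "s \<in> S" for s
        using that \<open>F 0 0 = 0\<close> \<open>0 \<in> S\<close> unfolding constant_on_def by metis
      then have "F 1 0 = 0"
        using analytic_continuation_open[of S UNIV "\<lambda>s. F s 0" "\<lambda>s. 0" 1] \<open>open S\<close> \<open>0 \<in> S\<close> holo
        by auto
      then show False using \<open>F 1 0 \<noteq> 0\<close> by simp
    qed
    show "F s (\<i> / of_nat (Suc n)) \<noteq> 0" if "s \<in> S" for n s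
    proof -
      have "0 < Im (Z s (\<i> / of_nat (Suc n)) x)" if "x \<in> V" for x
      proof (cases "x = v")
        case True
        have "Im (\<i> / of_nat (Suc n)) = 1 / real (Suc n)"
          by (simp only: Im_divide_of_nat imaginary_unit.simps)
        moreover have "0 < 1 / real (Suc n)" by simp
        moreover have "Z s (\<i> / of_nat (Suc n)) x = \<i> / of_nat (Suc n)" using True by (simp add: Z_def)
        ultimately show ?thesis by (simp only:)
      next
        case False
        then show ?thesis using that \<open>s \<in> S\<close> by (auto simp: Z_def V_def S_def)
      qed
      then show ?thesis
        using rigid rigid_iff_tree_sum[OF V] unfolding F_def V_def by blast
    qed
  qed (use holo \<open>0 \<in> S\<close> in auto)
  then show False using \<open>F 0 0 = 0\<close> by simp
qed

text \<open>\<open>W\<close> grows towards \<open>V\<close> by one adjacent vertex at a time, so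
  every intermediate set is connected, as \<open>rigid_insertD\<close> demands.\<close>

theorem rigid_subset:
  assumes V: "finite V" "conn V" "rigid V" and W: "W \<subseteq> V" "W \<noteq> {}" "conn W"
  shows "rigid W"
  using W
proof (induction "card (V - W)" arbitrary: W rule: less_induct)
  case less
  show ?case
  proof (cases "W = V")
    case False
    then obtain y where y: "y \<in> V" "y \<notin> W" using less by blast
    obtain x where x: "x \<in> W" using less by blast
    have "\<exists>u\<in>W. \<exists>v\<in>V - W. A v u" if "(rel_on V)\<^sup>*\<^sup>* x t" "t \<notin> W" for t
      using that
    proof (induction rule: rtranclp_induct)
      case base
      then show ?case using x by blast
    next
      case (step s t)
      then show ?case using adj_sym by (cases "s \<in> W") (auto simp: rel_on_def)
    qed
    then obtain u v where uv: "u \<in> W" "v \<in> V" "v \<notin> W" "A v u"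
      using connD[OF V(2), of x y] x y less by blast
    have "rigid (insert v W)"
    proof (rule less(1))
      show "card (V - insert v W) < card (V - W)"
        using uv V by (intro psubset_card_mono) auto
      show "conn (insert v W)" using conn_insert less uv by blast
    qed (use uv less in auto)
    then show ?thesis
      using rigid_insertD[OF _ less(4) uv(3,1,4)] finite_subset[OF less(2) V(1)] by blast
  qed (use V in simp)
qed

end

section \<open>Obstructions\<close>

context adjacency
begin

lemma conn_index:
  fixes h :: "nat \<Rightarrow> 'a"
  assumes "\<And>i. 0 < i \<Longrightarrow> i < n \<Longrightarrow> \<exists>j<i. A (h i) (h j)"
  shows "conn (h ` {..<n})"
proof (rule connI)
  fix t assume "t \<in> h ` {..<n}"
  then obtain i where "i < n" "t = h i" by auto
  moreover have "(rel_on (h ` {..<n}))\<^sup>*\<^sup>* (h i) (h 0)" if "i < n" for i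
    using that
  proof (induction i rule: less_induct)
    case (less i)
    show ?case
    proof (cases "i = 0")
      case False
      then obtain j where j: "j < i" "A (h i) (h j)" using assms[of i] less by auto
      then have "rel_on (h ` {..<n}) (h i) (h j)" using less by (auto simp: rel_on_def)
      then show ?thesis using less j by (meson converse_rtranclp_into_rtranclp less_trans)
    qed simp
  qed
  ultimately show "(rel_on (h ` {..<n}))\<^sup>*\<^sup>* t (h 0)" by simp
qed

lemma not_rigid_index:
  fixes h :: "nat \<Rightarrow> 'a" and \<zeta> \<phi> :: "nat \<Rightarrow> complex"
  assumes inj: "inj_on h {..<n}" and \<zeta>: "\<And>i. i < n \<Longrightarrow> 0 < Im (\<zeta> i)"
    and eq: "\<And>i. i < n \<Longrightarrow> (\<Sum>j<n. if A (h i) (h j) then \<zeta> j * (\<phi> i - \<phi> j) else 0) = 0"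
    and ik: "i < n" "k < n" "\<phi> i \<noteq> \<phi> k"
  shows "\<not> rigid (h ` {..<n})"
proof
  assume rigid: "rigid (h ` {..<n})"
  define z where "z = \<zeta> \<circ> inv_into {..<n} h"
  define f where "f = \<phi> \<circ> inv_into {..<n} h"
  have zf: "z (h i) = \<zeta> i" "f (h i) = \<phi> i" if "i < n" for i
    using inj that by (auto simp: z_def f_def)
  have "harmonic (h ` {..<n}) z f"
    unfolding harmonic_def
  proof
    fix v assume "v \<in> h ` {..<n}"
    then obtain i where i: "i < n" "v = h i" by auto
    have "(\<Sum>w\<in>h ` {..<n}. if A v w then z w * (f v - f w) else 0) =
        (\<Sum>j<n. if A v (h j) then z (h j) * (f v - f (h j)) else 0)"
      using inj by (simp add: sum.reindex)
    also have "\<dots> = (\<Sum>j<n. if A (h i) (h j) then \<zeta> j * (\<phi> i - \<phi> j) else 0)"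
      by (intro sum.cong) (auto simp: zf i)
    also have "\<dots> = 0" by (rule eq[OF i(1)])
    finally show "(\<Sum>w\<in>h ` {..<n}. if A v w then z w * (f v - f w) else 0) = 0" .
  qed
  then have "f (h i) = f (h k)"
    by (intro rigidD[OF rigid, of z f]) (use \<zeta> zf ik in auto)
  then show False using zf ik by simp
qed

text \<open>Nonemptiness and connectedness are what \<open>rigid_subset\<close> needs to carry the
  failure of rigidity over to a larger graph.\<close>

definition obstruction :: "'a set \<Rightarrow> bool" where
  "obstruction W \<longleftrightarrow> W \<noteq> {} \<and> conn W \<and> \<not> rigid W"

lemma house_obstruction:
  assumes "distinct [a, b, c, d, e]" "A a b" "A b c" "A c d" "A d a" "A e a" "A e b"
    "\<not> A a c" "\<not> A b d" "\<not> A e c" "\<not> A e d"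
  shows "obstruction {a, b, c, d, e}"
proof -
  define h where "h = (!) [a, b, c, d, e]"
  have h: "h 0 = a" "h (Suc 0) = b" "h 2 = c" "h 3 = d" "h 4 = e" by (simp_all add: h_def)
  have range: "{..<5 :: nat} = {0, 1, 2, 3, 4}" by auto
  have W: "h ` {..<5} = {a, b, c, d, e}" unfolding range by (simp add: h)
  have inj: "inj_on h {..<5}" unfolding range using assms(1) by (simp add: h)
  have edges: "A b a" "A c b" "A d c" "A a d" "A a e" "A b e"
    "\<not> A c a" "\<not> A d b" "\<not> A c e" "\<not> A d e"
    using assms(2-) adj_sym by blast+
  note adj = assms(2-) edges adj_irrefl h
  have "conn (h ` {..<5})"
  proof (rule conn_index)
    fix i :: nat assume "0 < i" "i < 5"
    then have "i \<in> {1, 2, 3, 4}" by auto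
    then show "\<exists>j<i. A (h i) (h j)"
      using adj by (elim insertE emptyE) (auto intro: exI[of _ 0] exI[of _ 1])
  qed
  moreover have "\<not> rigid (h ` {..<5})"
  proof (rule not_rigid_index[OF inj])
    \<comment> \<open>For fixed \<open>?\<phi>\<close> the equations say that
      \<open>?\<zeta>\<close> is in the kernel of a skew-symmetric matrix of order 5, with the
      differences of \<open>?\<phi>\<close> at the edges. Such a kernel contains the vector of
      signed Pfaffians of order 4; \<open>?\<zeta>\<close> is this vector times
      \<open>1 + \<i>\<close>, which moves all entries into the upper half-plane.\<close>
    let ?\<zeta> = "(!) [Complex 4 2, Complex (- 3) 1, Complex (- 4) 2, Complex 3 1, Complex 0 4]"
    let ?\<phi> = "(!) [Complex 0 0, Complex 0 1, Complex 2 0, Complex 1 2, Complex (- 1) 0]"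
    fix i :: nat assume "i < 5"
    then have i: "i \<in> {0, 1, 2, 3, 4}" by auto
    then show "0 < Im (?\<zeta> i)" by auto
    show "(\<Sum>j<5. if A (h i) (h j) then ?\<zeta> j * (?\<phi> i - ?\<phi> j) else 0) = 0"
      using i by (elim insertE emptyE) (simp_all add: range adj complex_eq_iff)
  next
    show "(0 :: nat) < 5" "(1 :: nat) < 5" by simp_all
  qed simp
  ultimately show ?thesis unfolding W obstruction_def by blast
qed

lemma gem_obstruction:
  assumes "distinct [a, b, c, d, e]" "A a b" "A b c" "A c d" "A e a" "A e b" "A e c" "A e d"
    "\<not> A a c" "\<not> A a d" "\<not> A b d"
  shows "obstruction {a, b, c, d, e}"
proof -
  define h where "h = (!) [a, b, c, d, e]"
  have h: "h 0 = a" "h (Suc 0) = b" "h 2 = c" "h 3 = d" "h 4 = e" by (simp_all add: h_def)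
  have range: "{..<5 :: nat} = {0, 1, 2, 3, 4}" by auto
  have W: "h ` {..<5} = {a, b, c, d, e}" unfolding range by (simp add: h)
  have inj: "inj_on h {..<5}" unfolding range using assms(1) by (simp add: h)
  have edges: "A b a" "A c b" "A d c" "A a e" "A b e" "A c e" "A d e"
    "\<not> A c a" "\<not> A d a" "\<not> A d b"
    using assms(2-) adj_sym by blast+
  note adj = assms(2-) edges adj_irrefl h
  have "conn (h ` {..<5})"
  proof (rule conn_index)
    fix i :: nat assume "0 < i" "i < 5"
    then have "i \<in> {1, 2, 3, 4}" by auto
    then show "\<exists>j<i. A (h i) (h j)"
      using adj by (elim insertE emptyE) (auto intro: exI[of _ 0] exI[of _ 1] exI[of _ 2])
  qed
  moreover have "\<not> rigid (h ` {..<5})"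
  proof (rule not_rigid_index[OF inj])
    \<comment> \<open>Again the vector of signed Pfaffians for \<open>?\<phi>\<close>, here times
      \<open>2 - \<i>\<close>. The values \<open>?\<phi>\<close> are symmetric under the half-turn
      about the value at \<open>e\<close>, which exchanges \<open>a\<close> with \<open>d\<close>
      and \<open>b\<close> with \<open>c\<close>; the weights respect this symmetry.\<close>
    let ?\<zeta> = "(!) [Complex (- 3) 4, Complex 3 1, Complex 3 1, Complex (- 3) 4, Complex (- 2) 1]"
    let ?\<phi> = "(!) [Complex 0 0, Complex 0 (- 1), Complex 2 (- 1), Complex 2 (- 2), Complex 1 (- 1)]"
    fix i :: nat assume "i < 5"
    then have i: "i \<in> {0, 1, 2, 3, 4}" by auto
    then show "0 < Im (?\<zeta> i)" by auto
    show "(\<Sum>j<5. if A (h i) (h j) then ?\<zeta> j * (?\<phi> i - ?\<phi> j) else 0) = 0"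
      using i by (elim insertE emptyE) (simp_all add: range adj complex_eq_iff)
  next
    show "(0 :: nat) < 5" "(1 :: nat) < 5" by simp_all
  qed simp
  ultimately show ?thesis unfolding W obstruction_def by blast
qed

lemma domino_obstruction:
  assumes "distinct [a, b, c, d, e, g]" "A a b" "A b c" "A c d" "A d e" "A e g" "A g a" "A b e"
    "\<not> A a c" "\<not> A a d" "\<not> A a e" "\<not> A b d" "\<not> A b g" "\<not> A c e" "\<not> A c g" "\<not> A d g"
  shows "obstruction {a, b, c, d, e, g}"
proof -
  define h where "h = (!) [a, b, c, d, e, g]"
  have h: "h 0 = a" "h (Suc 0) = b" "h 2 = c" "h 3 = d" "h 4 = e" "h 5 = g" by (simp_all add: h_def)
  have range: "{..<6 :: nat} = {0, 1, 2, 3, 4, 5}" by auto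
  have W: "h ` {..<6} = {a, b, c, d, e, g}" unfolding range by (simp add: h)
  have inj: "inj_on h {..<6}" unfolding range using assms(1) by (simp add: h)
  have edges: "A b a" "A c b" "A d c" "A e d" "A g e" "A a g" "A e b"
    "\<not> A c a" "\<not> A d a" "\<not> A e a" "\<not> A d b" "\<not> A g b" "\<not> A e c" "\<not> A g c" "\<not> A g d"
    using assms(2-) adj_sym by blast+
  note adj = assms(2-) edges adj_irrefl h
  have "conn (h ` {..<6})"
  proof (rule conn_index)
    fix i :: nat assume "0 < i" "i < 6"
    then have "i \<in> {1, 2, 3, 4, 5}" by auto
    then show "\<exists>j<i. A (h i) (h j)"
      using adj by (elim insertE emptyE) (auto intro: exI[of _ 0] exI[of _ 1] exI[of _ 2])
  qed
  moreover have "\<not> rigid (h ` {..<6})"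
  proof (rule not_rigid_index[OF inj])
    \<comment> \<open>The values at \<open>b\<close> and \<open>e\<close> agree, so the chord
      between them contributes nothing and a harmonic function on the hexagon remains. The half-turn
      about this common value exchanges \<open>a\<close> with \<open>c\<close> and \<open>d\<close>
      with \<open>g\<close>; the weights respect it.\<close>
    let ?\<zeta> = "(!) [Complex 3 1, Complex 1 1, Complex 3 1, Complex (- 1) 1, Complex (- 2) 1,
      Complex (- 1) 1]"
    let ?\<phi> = "(!) [Complex 0 0, Complex (- 1) 0, Complex (- 2) 0, Complex (- 2) 1,
      Complex (- 1) 0, Complex 0 (- 1)]"
    fix i :: nat assume "i < 6"
    then have i: "i \<in> {0, 1, 2, 3, 4, 5}" by auto
    then show "0 < Im (?\<zeta> i)" by auto
    show "(\<Sum>j<6. if A (h i) (h j) then ?\<zeta> j * (?\<phi> i - ?\<phi> j) else 0) = 0"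
      using i by (elim insertE emptyE) (simp_all add: range adj complex_eq_iff)
  next
    show "(0 :: nat) < 6" "(1 :: nat) < 6" by simp_all
  qed simp
  ultimately show ?thesis unfolding W obstruction_def by blast
qed

section \<open>Induced paths and long cycles\<close>

definition induced_path :: "(nat \<Rightarrow> 'a) \<Rightarrow> nat \<Rightarrow> bool" where
  "induced_path q m \<longleftrightarrow> inj_on q {..m} \<and>
     (\<forall>a\<le>m. \<forall>b\<le>m. A (q a) (q b) \<longleftrightarrow> b = Suc a \<or> a = Suc b)"

lemma induced_path_Cons:
  assumes q: "induced_path q m" and u: "u \<notin> q ` {..m}" "\<And>i. i \<le> m \<Longrightarrow> A u (q i) \<longleftrightarrow> i = 0"
  shows "induced_path (case_nat u q) (Suc m)"
  unfolding induced_path_def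
proof
  show "inj_on (case_nat u q) {..Suc m}"
  proof (rule inj_onI)
    fix a b assume "a \<in> {..Suc m}" "b \<in> {..Suc m}" "case_nat u q a = case_nat u q b"
    then show "a = b"
      using q u(1) unfolding induced_path_def inj_on_def by (cases a; cases b) (auto simp: image_iff)
  qed
  show "\<forall>a\<le>Suc m. \<forall>b\<le>Suc m. A (case_nat u q a) (case_nat u q b) \<longleftrightarrow> b = Suc a \<or> a = Suc b"
  proof (intro allI impI)
    fix a b assume "a \<le> Suc m" "b \<le> Suc m"
    moreover have "A (q i) u \<longleftrightarrow> i = 0" if "i \<le> m" for i using u(2)[OF that] adj_sym by blast
    ultimately show "A (case_nat u q a) (case_nat u q b) \<longleftrightarrow> b = Suc a \<or> a = Suc b"
      using q u(2) adj_irrefl unfolding induced_path_def by (cases a; cases b) auto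
  qed
qed

text \<open>
  On a cycle, harmonicity for the weights \<open>-1 / y\<^sub>i\<close> says that the increments of \<open>f\<close> are
  proportional to \<open>y\<^sub>i y\<^sub>i\<^sub>+\<^sub>1\<close>. So it suffices that these products sum to \<open>0\<close>, which is possible
  in the upper half-plane from length \<open>5\<close> on.
\<close>

lemma hole_obstruction:
  assumes q: "induced_path q m" "3 \<le> m"
    and v: "v \<notin> q ` {..m}" "\<And>i. i \<le> m \<Longrightarrow> A v (q i) \<longleftrightarrow> i = 0 \<or> i = m"
  shows "obstruction (insert v (q ` {..m}))"
proof -
  define h where "h i = (if i \<le> m then q i else v)" for i
  define n where "n = Suc (Suc m)"
  have hq: "h i = q i" if "i \<le> m" for i using that by (simp add: h_def)
  have hv: "h (Suc m) = v" by (simp add: h_def)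
  have range: "{..<n} = insert (Suc m) {..m}" by (auto simp: n_def)
  have W: "h ` {..<n} = insert v (q ` {..m})" unfolding range by (simp add: hv hq)
  have inj: "inj_on h {..<n}"
    using q(1) v(1) unfolding range induced_path_def by (auto simp: inj_on_def hv hq image_iff)
  have adj: "A (h i) (h j) \<longleftrightarrow> j = Suc i \<or> i = Suc j \<or> {i, j} = {0, Suc m}"
    if ij: "i < n" "j < n" for i j
  proof -
    have vq: "A (q k) v \<longleftrightarrow> k = 0 \<or> k = m" if "k \<le> m" for k
      using v(2)[OF that] adj_sym by blast
    consider "i \<le> m" "j \<le> m" | "i = Suc m" "j \<le> m" | "i \<le> m" "j = Suc m" | "i = Suc m" "j = Suc m"
      using ij by (fastforce simp: n_def)
    then show ?thesis
    proof cases
      case 1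
      then show ?thesis using q(1) unfolding induced_path_def by (auto simp: hq doubleton_eq_iff)
    next
      case 2
      then show ?thesis using v(2)[of j] by (auto simp: hq hv doubleton_eq_iff)
    next
      case 3
      then show ?thesis using vq[of i] by (auto simp: hq hv doubleton_eq_iff)
    next
      case 4
      then show ?thesis using adj_irrefl by (auto simp: doubleton_eq_iff)
    qed
  qed
  have "conn (h ` {..<n})"
  proof (rule conn_index)
    fix i assume i: "0 < i" "i < n"
    then show "\<exists>j<i. A (h i) (h j)" by (intro exI[of _ "i - 1"]) (auto simp: adj)
  qed
  \<comment> \<open>Put \<open>y j = \<i> + t j\<close> with real \<open>t j\<close>. The cyclic sum
    of the products is the sum of the \<open>t j * t (j + 1)\<close>, minus \<open>n\<close>, plus
    \<open>2 * \<i>\<close> times the sum of the \<open>t j\<close>. The choice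
    \<open>a, a, -a, -a, 0, ..., 0\<close> makes it \<open>a * a - n\<close>. In length 4 the
    closing product would be \<open>- a * a\<close> and spoil this.\<close>
  define a where "a = complex_of_real (sqrt (real n))"
  have a2: "a * a = of_nat n"
    unfolding a_def of_real_mult[symmetric] by simp
  define y where "y i = (if i \<le> 1 then \<i> + a else if i \<le> 3 then \<i> - a else \<i>)" for i :: nat
  have Imy: "Im (y i) = 1" for i by (simp add: y_def a_def)
  then have y0: "y i \<noteq> 0" for i by (metis zero_complex.simps(2) zero_neq_one)
  have y_last: "y (Suc m) = \<i>" using q(2) by (simp add: y_def)
  define \<phi> where "\<phi> i = (\<Sum>j<i. y j * y (Suc j))" for i
  have \<phi>_Suc: "\<phi> (Suc i) = \<phi> i + y i * y (Suc i)" for i by (simp add: \<phi>_def)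
  \<comment> \<open>The sum of all products but the closing one \<open>y (Suc m) * y 0\<close>, as
    \<open>y (Suc m) = \<i>\<close>.\<close>
  have "\<phi> m + y m * \<i> = a * a - of_nat (Suc m) - \<i> * a"
    using q(2)
  proof (induction m rule: nat_induct_at_least)
    case base
    show ?case
      by (simp add: \<phi>_def y_def numeral_3_eq_3 algebra_simps)
  next
    case (Suc m)
    then have "y (Suc m) = \<i>" by (simp add: y_def)
    then show ?case using Suc by (simp add: \<phi>_Suc algebra_simps)
  qed
  then have "\<phi> (Suc m) = of_nat n - of_nat (Suc m) - \<i> * a"
    using y_last by (simp add: \<phi>_Suc a2)
  then have closed: "\<phi> (Suc m) = - (y (Suc m) * y 0)"
    unfolding y_last n_def by (simp add: y_def algebra_simps)
  define \<zeta> where "\<zeta> i = - 1 / y i" for i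
  have "\<not> rigid (h ` {..<n})"
  proof (rule not_rigid_index[OF inj])
    fix i assume i: "i < n"
    show "0 < Im (\<zeta> i)"
      using Imy[of i] y0[of i] by (simp add: \<zeta>_def Im_divide add_nonneg_pos)
    have two: "(\<Sum>j<n. if A (h i) (h j) then \<zeta> j * (\<phi> i - \<phi> j) else 0) =
        \<zeta> j * (\<phi> i - \<phi> j) + \<zeta> k * (\<phi> i - \<phi> k)"
      if "j < n" "k < n" "j \<noteq> k" "\<And>l. l < n \<Longrightarrow> A (h i) (h l) \<longleftrightarrow> l = j \<or> l = k" for j k
    proof -
      have "(\<Sum>l<n. if A (h i) (h l) then \<zeta> l * (\<phi> i - \<phi> l) else 0) =
          (\<Sum>l\<in>{l \<in> {..<n}. A (h i) (h l)}. \<zeta> l * (\<phi> i - \<phi> l))"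
        by (rule sum.inter_filter[symmetric]) simp
      also have "{l \<in> {..<n}. A (h i) (h l)} = {j, k}" using that by auto
      finally show ?thesis using that(3) by simp
    qed
    consider "i = 0" | "i = Suc m" | i' where "i = Suc i'" "i < Suc m"
      using i by (cases i) (auto simp: n_def less_Suc_eq)
    then show "(\<Sum>j<n. if A (h i) (h j) then \<zeta> j * (\<phi> i - \<phi> j) else 0) = 0"
    proof cases
      case 1
      have \<phi>: "\<phi> 0 = 0" "\<phi> (Suc 0) = y 0 * y (Suc 0)" by (simp_all add: \<phi>_def)
      show ?thesis
        by (subst two[of 1 "Suc m"])
           (use 1 q(2) in \<open>auto simp: n_def adj doubleton_eq_iff \<phi> closed \<zeta>_def y0\<close>)
    next
      case 2
      have \<phi>: "\<phi> 0 = 0" by (simp add: \<phi>_def)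
      have "(\<Sum>j<n. if A (h i) (h j) then \<zeta> j * (\<phi> i - \<phi> j) else 0) =
          \<zeta> m * (\<phi> i - \<phi> m) + \<zeta> 0 * (\<phi> i - \<phi> 0)"
        by (rule two) (use 2 q(2) in \<open>auto simp: n_def adj doubleton_eq_iff\<close>)
      moreover have "\<phi> i - \<phi> m = y m * y i" using 2 by (simp add: \<phi>_Suc)
      moreover have "\<phi> i - \<phi> 0 = - (y i * y 0)" using 2 closed \<phi> by simp
      ultimately show ?thesis using y0 by (simp add: \<zeta>_def)
    next
      case 3
      have "(\<Sum>j<n. if A (h i) (h j) then \<zeta> j * (\<phi> i - \<phi> j) else 0) =
          \<zeta> i' * (\<phi> i - \<phi> i') + \<zeta> (Suc i) * (\<phi> i - \<phi> (Suc i))"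
        by (rule two) (use 3 q(2) in \<open>auto simp: n_def adj doubleton_eq_iff\<close>)
      moreover have "\<phi> i - \<phi> i' = y i' * y i" using 3 by (simp add: \<phi>_Suc)
      moreover have "\<phi> i - \<phi> (Suc i) = - (y i * y (Suc i))" by (simp add: \<phi>_Suc)
      ultimately show ?thesis using y0 by (simp add: \<zeta>_def)
    qed
  next
    show "0 < n" "1 < n" "\<phi> 0 \<noteq> \<phi> 1" using y0 by (simp_all add: n_def \<phi>_def)
  qed
  with \<open>conn (h ` {..<n})\<close> show ?thesis unfolding W obstruction_def by blast
qed


text \<open>
  A violation of \<open>dist_hered_same_lower\<close>, minimal first in the level \<open>j\<close> and then in the
  length \<open>l\<close> of the path \<open>p\<close>, spans together with two neighbours \<open>w\<close>, \<open>w'\<close> of its ends in level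
  \<open>j - 1\<close> and a common neighbour \<open>c\<close> of these in level \<open>j - 2\<close> a graph containing an obstruction.
\<close>

lemma not_dist_hered_obstruction:
  assumes V: "conn V" and nd: "\<not> dist_hered V"
  shows "\<exists>W\<subseteq>V. obstruction W"
proof -
  define L where "L r j = {t \<in> V. j \<le> dst V t r}" for r j
  define viol where "viol r j l x y w \<longleftrightarrow> x \<in> V \<and> y \<in> V \<and> w \<in> V \<and> dst V x r = j \<and> dst V y r = j \<and>
    Suc (dst V w r) = j \<and> A x w \<and> \<not> A y w \<and> (rel_on (L r j) ^^ l) x y" for r j l x y w
  have "\<exists>r\<in>V. \<exists>j l x y w. viol r j l x y w"
  proof (rule ccontr)
    assume no: "\<not> (\<exists>r\<in>V. \<exists>j l x y w. viol r j l x y w)"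
    have "dist_hered V"
    proof (rule dist_hered_if_same_lower[OF V])
      fix r j x y w
      assume *: "r \<in> V" "x \<in> V" "y \<in> V" "w \<in> V" "dst V x r = j" "dst V y r = j"
        "Suc (dst V w r) = j" "A x w" "(rel_on {t \<in> V. j \<le> dst V t r})\<^sup>*\<^sup>* x y"
      obtain l where "(rel_on (L r j) ^^ l) x y"
        using rtranclp_imp_relpowp[OF *(9)] unfolding L_def by blast
      then have "viol r j l x y w" if "\<not> A y w" unfolding viol_def using * that by simp
      then show "A y w" using no *(1) by blast
    qed
    then show False using nd by contradiction
  qed
  then obtain r j0 l0 x0 y0 w0 where r: "r \<in> V" and viol0: "viol r j0 l0 x0 y0 w0" by blast
  define j where "j = (LEAST j. \<exists>l x y w. viol r j l x y w)"
  have j_ex: "\<exists>l x y w. viol r j l x y w"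
    unfolding j_def by (rule LeastI_ex) (use viol0 in \<open>intro exI\<close>)
  have j_min: "\<not> viol r i l x y w" if "i < j" for i l x y w
    using not_less_Least[of i "\<lambda>j. \<exists>l x y w. viol r j l x y w"] that unfolding j_def by blast
  define l where "l = (LEAST l. \<exists>x y w. viol r j l x y w)"
  have "\<exists>x y w. viol r j l x y w"
    unfolding l_def by (rule LeastI_ex) (rule j_ex)
  then obtain x y w where viol: "viol r j l x y w" by blast
  have l_min: "\<not> viol r j i x y w" if "i < l" for i x y w
    using not_less_Least[of i "\<lambda>l. \<exists>x y w. viol r j l x y w"] that unfolding l_def by blast
  define d where "d t = dst V t r" for t
  have d_adj: "d u \<le> Suc (d v)" if "u \<in> V" "v \<in> V" "A u v" for u v
    using that dst_adj V r by (auto simp: d_def)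
  have d_Suc: "\<exists>w\<in>V. A u w \<and> d w = m" if "u \<in> V" "d u = Suc m" for u m
    using that dst_SucE V r by (metis d_def)
  have v: "x \<in> V" "y \<in> V" "w \<in> V" "d x = j" "d y = j" "Suc (d w) = j" "A x w" "\<not> A y w"
    and path: "(rel_on (L r j) ^^ l) x y"
    using viol unfolding viol_def d_def by auto
  have vs: "A w x" "\<not> A w y" using v adj_sym by blast+
  let ?R = "rel_on (L r j)"
  obtain p where p: "p 0 = x" "p l = y" "\<And>i. i < l \<Longrightarrow> ?R (p i) (p (Suc i))"
    using path unfolding relpowp_fun_conv by blast
  have seg: "(?R ^^ (b - a)) (p a) (p b)" if "a \<le> b" "b \<le> l" for a b
    unfolding relpowp_fun_conv using that p(3) by (intro exI[of _ "\<lambda>i. p (a + i)"]) auto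
  have "l \<noteq> 0" using p v by metis
  have pV: "p i \<in> V" "j \<le> d (p i)" if "i \<le> l" for i
  proof -
    have "p i \<in> L r j"
      using that p(3)[of i] p(3)[of "i - 1"] \<open>l \<noteq> 0\<close> by (cases "i < l") (auto simp: rel_on_def)
    then show "p i \<in> V" "j \<le> d (p i)" by (auto simp: L_def d_def)
  qed
  \<comment> \<open>Minimality of \<open>l\<close>: an inner vertex of level \<open>j\<close> splits
    the path, and depending on its adjacency to \<open>w\<close> one of the two pieces is a shorter
    violation.\<close>
  have interior: "j < d (p i)" if i: "0 < i" "i < l" for i
  proof (rule ccontr)
    assume "\<not> j < d (p i)"
    then have pi: "p i \<in> V" "d (p i) = j" using pV[of i] i by auto
    show False
    proof (cases "A (p i) w")
      case True
      have "(?R ^^ (l - i)) (p i) y" using seg[of i l] i p by auto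
      then have "viol r j (l - i) (p i) y w" unfolding viol_def using v pi True d_def by auto
      then show False using l_min[of "l - i"] i by auto
    next
      case False
      have "(?R ^^ i) x (p i)" using seg[of 0 i] i p by auto
      then have "viol r j i x (p i) w" unfolding viol_def using v pi False d_def by auto
      then show False using l_min[of i] i by auto
    qed
  qed
  have shortest: "l \<le> k" if "(?R ^^ k) x y" for k
    using that l_min[of k x y w] viol unfolding viol_def by (meson not_le)
  have p_inj: "p a \<noteq> p b" if ab: "a < b" "b \<le> l" for a b
  proof
    assume eq: "p a = p b"
    have "(?R ^^ a) x (p a)" using seg[of 0 a] ab p by auto
    moreover have "(?R ^^ (l - b)) (p a) y" using seg[of b l] ab p eq by auto
    ultimately have "(?R ^^ (a + (l - b))) x y" by (rule relpowp_trans)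
    then show False using shortest ab by fastforce
  qed
  have p_adj: "A (p a) (p b) \<longleftrightarrow> b = Suc a" if ab: "a < b" "b \<le> l" for a b
  proof
    assume "A (p a) (p b)"
    then have "?R (p a) (p b)" using pV[of a] pV[of b] ab by (auto simp: rel_on_def L_def d_def)
    moreover have "(?R ^^ a) x (p a)" using seg[of 0 a] ab p by auto
    ultimately have "(?R ^^ Suc a) x (p b)" by (metis relpowp_Suc_I)
    moreover have "(?R ^^ (l - b)) (p b) y" using seg[of b l] ab p by auto
    ultimately have "(?R ^^ (Suc a + (l - b))) x y" by (rule relpowp_trans)
    then show "b = Suc a" using shortest ab by fastforce
  next
    assume "b = Suc a"
    then show "A (p a) (p b)" using p(3)[of a] ab by (auto simp: rel_on_def)
  qed
  have ipath: "induced_path p l"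
    unfolding induced_path_def
  proof (intro conjI allI impI)
    show "inj_on p {..l}" by (rule linorder_inj_onI) (use p_inj in auto)
    fix a b assume ab: "a \<le> l" "b \<le> l"
    consider "a < b" | "b < a" | "a = b" by linarith
    then show "A (p a) (p b) \<longleftrightarrow> b = Suc a \<or> a = Suc b"
    proof cases
      case 2
      then show ?thesis
        using p_adj[of b a] ab adj_sym[of "p a" "p b"] adj_sym[of "p b" "p a"] by auto
    qed (use p_adj[of a b] ab adj_irrefl in auto)
  qed
  obtain i where i: "j = Suc i" "d w = i" using v by metis
  obtain w' where w': "w' \<in> V" "A y w'" "d w' = i" using d_Suc v i by metis
  have w'y: "A w' y" using w' adj_sym by blast
  have "w' \<noteq> w" using w' v by auto
  have "i \<noteq> 0"
  proof
    assume "i = 0"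
    then have "w = r" "w' = r" using dst_eq_0[OF V] v w' i r by (auto simp: d_def)
    then show False using \<open>w' \<noteq> w\<close> by simp
  qed
  then obtain i' where i': "i = Suc i'" by (cases i) auto
  obtain c where c: "c \<in> V" "A w c" "d c = i'" using d_Suc v i i' by metis
  \<comment> \<open>Minimality of \<open>j\<close>: otherwise the extended path
    \<open>w, x, ..., y, w'\<close>, which stays in the levels from \<open>i = j - 1\<close> on, is
    a violation with \<open>c\<close> as the lower vertex.\<close>
  have cw': "A w' c"
  proof (rule ccontr)
    assume "\<not> A w' c"
    have mono: "rel_on (L r j) \<le> rel_on (L r i)"
      using i by (auto simp: rel_on_def L_def)
    have ends: "rel_on (L r i) w x" "rel_on (L r i) y w'"
      using v vs w' i by (auto simp: rel_on_def L_def d_def)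
    let ?R' = "rel_on (L r i)"
    have "(?R' ^^ l) x y"
      by (rule relpowp_mono[OF predicate2D[OF mono] path])
    then have "(?R' ^^ Suc l) w y"
      using relpowp_Suc_I2[of ?R' w x l y] ends(1) by blast
    then have "(?R' ^^ Suc (Suc l)) w w'"
      using relpowp_Suc_I[of "Suc l" ?R' w y w'] ends(2) by blast
    then have "viol r i (Suc (Suc l)) w w' c"
      unfolding viol_def using v w' c i i' \<open>\<not> A w' c\<close> by (auto simp: d_def)
    then show False using j_min[of i] i by auto
  qed
  have far: "\<not> A u t" "\<not> A t u" "u \<noteq> t" if "u \<in> V" "t \<in> V" "Suc (d u) < d t" for u t
    using that d_adj[of t u] adj_sym[of u t] by auto
  have c_far: "\<not> A c (p k)" "\<not> A (p k) c" "c \<noteq> p k" if "k \<le> l" for k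
    using far[of c "p k"] pV[OF that] c i i' by auto
  have u_far: "\<not> A u (p k)" "\<not> A (p k) u" if "u \<in> V" "d u = i" "0 < k" "k < l" for u k
    using far[of u "p k"] pV[of k] interior[of k] that i by auto
  have u_neq: "u \<noteq> p k" if "d u = i" "k \<le> l" for u k
    using pV[of k] that i by auto
  have w_adj: "A w (p k) \<longleftrightarrow> k = 0" if "k \<le> l" for k
  proof (cases "0 < k \<and> k < l")
    case True
    then show ?thesis using u_far[of w k] v i by auto
  next
    case False
    then have "k = 0 \<or> k = l" using that by auto
    then show ?thesis using p(1,2) vs \<open>l \<noteq> 0\<close> by auto
  qed
  have w'_adj: "A w' (p k) \<longleftrightarrow> k = l \<or> k = 0 \<and> A w' x" if "k \<le> l" for k
  proof (cases "0 < k \<and> k < l")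
    case True
    then show ?thesis using u_far[of w' k] w' by auto
  next
    case False
    then have "k = 0 \<or> k = l" using that by auto
    then show ?thesis using p(1,2) w'y by auto
  qed
  have pw: "w \<notin> p ` {..l}" "w' \<notin> p ` {..l}" "c \<notin> p ` {..l}"
    using u_neq[OF i(2)] u_neq[OF w'(3)] c_far(3) unfolding image_iff by blast+
  have cw: "c \<noteq> w" "c \<noteq> w'" "A c w" "A c w'" "A w c" "A w' c"
    using c w' i i' adj_sym[OF c(2)] adj_sym[OF cw'] cw' by auto
  have pVs: "p ` {..l} \<subseteq> V" using pV by auto
  show ?thesis
  \<comment> \<open>If \<open>w'\<close> is adjacent to \<open>x\<close>, then \<open>l = 1\<close>
    gives a gem or a house, \<open>l = 2\<close> a house or a domino, depending on the edge between
    \<open>w\<close> and \<open>w'\<close>, and a longer path closes to a hole through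
    \<open>w'\<close>. Otherwise, if \<open>w\<close> and \<open>w'\<close> are adjacent, there is a
    house for \<open>l = 1\<close> and a hole through \<open>w\<close> and \<open>w'\<close> for
    longer paths; if not, the hole passes through \<open>c\<close> as well.\<close>
  proof (cases "A w' x")
    case w'x: True
    have x_w': "A x w'" using w'x adj_sym by blast
    consider "l = 1" | "l = 2" | "3 \<le> l" using \<open>l \<noteq> 0\<close> by linarith
    then show ?thesis
    proof cases
      case 1
      have xy: "x \<noteq> y" "A x y" using p_inj[of 0 1] p_adj[of 0 1] 1 p by auto
      have dist: "distinct [c, w, w', x, y]"
        using c_far[of 0] c_far[of 1] u_neq[of w 0] u_neq[of w 1] u_neq[of w' 0] u_neq[of w' 1]
          cw 1 p xy w' i \<open>w' \<noteq> w\<close> by auto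
      have n: "\<not> A c x" "\<not> A c y" "\<not> A w y" "\<not> A y c" "\<not> A x c"
        using c_far[of 0] c_far[of 1] 1 p vs by auto
      show ?thesis
      proof (cases "A w w'")
        case True
        have "obstruction {c, w, x, y, w'}"
          by (rule gem_obstruction) (use dist n cw xy v vs w' w'y w'x x_w' True adj_sym[OF True] in auto)
        then show ?thesis using v w' c by (intro exI[of _ "{c, w, x, y, w'}"]) auto
      next
        case False
        then have False_sym: "\<not> A w' w" using adj_sym by blast
        have "obstruction {x, w', c, w, y}"
          by (rule house_obstruction) (use dist n cw cw' xy adj_sym[OF xy(2)] v vs w' w'y w'x x_w' False_sym in auto)
        then show ?thesis using v w' c by (intro exI[of _ "{x, w', c, w, y}"]) auto
      qed
    next
      case 2
      define m where "m = p 1"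
      have m: "m \<in> V" "x \<noteq> m" "m \<noteq> y" "x \<noteq> y" "A x m" "A m y" "\<not> A x y"
        using pV[of 1] p_inj[of 0 1] p_inj[of 1 2] p_inj[of 0 2] p_adj[of 0 1] p_adj[of 1 2]
          p_adj[of 0 2] 2 p unfolding m_def by (auto simp: numeral_2_eq_2)
      have dist: "distinct [c, w, w', x, m, y]"
        using c_far[of 0] c_far[of 1] c_far[of 2] u_neq[of w 0] u_neq[of w 1] u_neq[of w 2]
          u_neq[of w' 0] u_neq[of w' 1] u_neq[of w' 2] cw 2 p m w' i \<open>w' \<noteq> w\<close> unfolding m_def by auto
      have y_x: "\<not> A y x" using m(7) adj_sym by blast
      have n: "\<not> A c x" "\<not> A c m" "\<not> A c y" "\<not> A w y" "\<not> A w m" "\<not> A w' m" "\<not> A m w'" "\<not> A m c"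
        "\<not> A x c" "\<not> A y c" "\<not> A y x"
        using c_far[of 0] c_far[of 1] c_far[of 2] u_far[of w 1] u_far[of w' 1] 2 p v vs w' i m(7) y_x
        unfolding m_def by auto
      show ?thesis
      proof (cases "A w w'")
        case True
        have "obstruction {x, w', y, m, w}"
          by (rule house_obstruction) (use dist n m adj_sym[OF m(5)] adj_sym[OF m(6)] v vs w' w'y w'x x_w' True in auto)
        then show ?thesis using v w' m by (intro exI[of _ "{x, w', y, m, w}"]) auto
      next
        case False
        then have False_sym: "\<not> A w' w" using adj_sym by blast
        have "obstruction {w, x, m, y, w', c}"
          by (rule domino_obstruction) (use dist n m cw cw' v vs w' w'y w'x x_w' False False_sym in auto)
        then show ?thesis using v w' m c by (intro exI[of _ "{w, x, m, y, w', c}"]) auto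
      qed
    next
      case 3
      have "obstruction (insert w' (p ` {..l}))"
        by (rule hole_obstruction[OF ipath 3 pw(2)]) (use w'_adj w'x in auto)
      then show ?thesis using w' pVs by (intro exI[of _ "insert w' (p ` {..l})"]) auto
    qed
  next
    case w'x: False
    have x_w': "\<not> A x w'" using w'x adj_sym by blast
    define q where "q = case_nat w p"
    have q: "induced_path q (Suc l)"
      unfolding q_def by (rule induced_path_Cons[OF ipath pw(1) w_adj])
    have q_simps: "q 0 = w" "q (Suc k) = p k" for k by (simp_all add: q_def)
    have q_image: "q ` {..Suc l} = insert w (p ` {..l})"
      unfolding atMost_Suc_eq_insert_0 image_insert image_image q_simps ..
    have w'_q: "A w' (q k) \<longleftrightarrow> k = Suc l \<or> k = 0 \<and> A w' w" if "k \<le> Suc l" for k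
      using that w'_adj w'x by (cases k) (auto simp: q_simps)
    have w'_notin: "w' \<notin> q ` {..Suc l}" using pw(2) \<open>w' \<noteq> w\<close> unfolding q_image by auto
    show ?thesis
    proof (cases "A w' w")
      case True
      show ?thesis
      proof (cases "l = 1")
        case l: True
        have xy: "x \<noteq> y" "A x y" using p_inj[of 0 1] p_adj[of 0 1] l p by auto
        have dist: "distinct [c, w, w', x, y]"
          using c_far[of 0] c_far[of 1] u_neq[of w 0] u_neq[of w 1] u_neq[of w' 0] u_neq[of w' 1]
            cw l p xy w' i \<open>w' \<noteq> w\<close> by auto
        have n: "\<not> A c x" "\<not> A c y" "\<not> A w y"
          using c_far[of 0] c_far[of 1] l p vs by auto
        have "obstruction {w, w', y, x, c}"
          by (rule house_obstruction) (use dist n cw cw' xy adj_sym[OF xy(2)] v vs w' w'y w'x x_w' True adj_sym[OF True] in auto)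
        then show ?thesis using v w' c by (intro exI[of _ "{w, w', y, x, c}"]) auto
      next
        case False
        then have "3 \<le> Suc l" using \<open>l \<noteq> 0\<close> by linarith
        then have "obstruction (insert w' (q ` {..Suc l}))"
          by (rule hole_obstruction[OF q _ w'_notin]) (use w'_q True in auto)
        then show ?thesis using w' pVs v q_image by (intro exI[of _ "insert w' (q ` {..Suc l})"]) auto
      qed
    next
      case False
      define q' where "q' = case_nat c q"
      have c_q: "A c (q k) \<longleftrightarrow> k = 0" if "k \<le> Suc l" for k
        using that cw c_far by (cases k) (auto simp: q_simps)
      have "c \<notin> q ` {..Suc l}" using pw(3) cw unfolding q_image by auto
      then have q': "induced_path q' (Suc (Suc l))"
        unfolding q'_def by (intro induced_path_Cons[OF q] c_q)
      have q'_simps: "q' 0 = c" "q' (Suc k) = q k" for k by (simp_all add: q'_def)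
      have q'_image: "q' ` {..Suc (Suc l)} = insert c (q ` {..Suc l})"
        unfolding atMost_Suc_eq_insert_0[of "Suc l"] image_insert image_image q'_simps ..
      have "3 \<le> Suc (Suc l)" using \<open>l \<noteq> 0\<close> by linarith
      moreover have "w' \<notin> q' ` {..Suc (Suc l)}" using w'_notin cw unfolding q'_image by auto
      moreover have "A w' (q' k) \<longleftrightarrow> k = 0 \<or> k = Suc (Suc l)" if "k \<le> Suc (Suc l)" for k
        using that w'_q False cw' by (cases k) (auto simp: q'_simps)
      ultimately have "obstruction (insert w' (q' ` {..Suc (Suc l)}))"
        by (intro hole_obstruction[OF q'])
      then show ?thesis using w' pVs v c unfolding q'_image q_image
        by (intro exI[of _ "insert w' (insert c (insert w (p ` {..l})))"]) auto
    qed
  qed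
qed

end

section \<open>Spanning trees as parent functions\<close>

text \<open>The bound on distances is carried along to keep the path simple: the new vertex
  \<open>u\<close> is farther from \<open>v\<close> than all vertices of \<open>p\<close>.\<close>

lemma (in adjacency) dst_path:
  assumes U: "conn U" "v \<in> U" and "u \<in> U" "dst U u v = k"
  shows "\<exists>p. p \<noteq> [] \<and> hd p = u \<and> last p = v \<and> length p = Suc k \<and> successively A p \<and> distinct p \<and>
    set p \<subseteq> U \<and> (\<forall>t\<in>set p. dst U t v \<le> k)"
  using assms(3,4)
proof (induction k arbitrary: u)
  case 0
  then have "u = v" using dst_eq_0[OF U(1) _ U(2)] by blast
  then show ?case using 0 by (intro exI[of _ "[u]"]) simp
next
  case (Suc k)
  obtain w where w: "w \<in> U" "A u w" "dst U w v = k"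
    by (rule dst_SucE[OF U(1) Suc(2) U(2) Suc(3)])
  obtain p where p: "p \<noteq> []" "hd p = w" "last p = v" "length p = Suc k" "successively A p"
    "distinct p" "set p \<subseteq> U" "\<forall>t\<in>set p. dst U t v \<le> k"
    using Suc.IH[OF w(1,3)] by blast
  have "u \<notin> set p" using p(8) Suc(3) by force
  moreover have "\<forall>t\<in>set (u # p). dst U t v \<le> Suc k" using p(8) Suc(3) by auto
  ultimately show ?case
    using p w(2) Suc(2) by (intro exI[of _ "u # p"]) (simp add: successively_Cons)
qed

text \<open>Only the edge set is fixed, so the same locale serves for induced subgraphs on varying
  vertex sets and, interpreted again, for spanning trees.\<close>

locale edge_graph =
  fixes E :: "'a set set"
  assumes card_edge: "e \<in> E \<Longrightarrow> card e = 2"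
begin

sublocale adjacency "\<lambda>u v. {u, v} \<in> E"
proof
  show "{u, v} \<in> E \<Longrightarrow> {v, u} \<in> E" for u v by (simp add: insert_commute)
  show "{u, u} \<notin> E" for u using card_edge[of "{u, u}"] by auto
qed

lemma edge_graph_subset: "F \<subseteq> E \<Longrightarrow> edge_graph F"
  using card_edge by unfold_locales blast

lemma edgeE:
  assumes "e \<in> E"
  obtains x y where "e = {x, y}" "x \<noteq> y"
  using card_edge[OF assms] by (auto simp: card_2_iff)

section \<open>Walks, connectedness and distances in terms of the adjacency relation\<close>

lemma walk_iff_relpow:
  assumes "u \<in> U"
  shows "(\<exists>p. walk_between U (induced_edges E U) u p v \<and> length p = Suc k) \<longleftrightarrow> (rel_on U ^^ k) u v"
proof
  assume "\<exists>p. walk_between U (induced_edges E U) u p v \<and> length p = Suc k"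
  then obtain p where p: "walk_between U (induced_edges E U) u p v" "length p = Suc k" by blast
  have "p ! 0 = u" "p ! k = v"
    using p by (auto simp: walk_between_def graph_walk_def hd_conv_nth last_conv_nth)
  moreover have "rel_on U (p ! i) (p ! Suc i)" if "i < k" for i
  proof -
    have "{p ! i, p ! Suc i} \<in> induced_edges E U"
      using p that by (auto simp: walk_between_def graph_walk_def successively_conv_nth)
    then show ?thesis by (auto simp: induced_edges_def rel_on_def)
  qed
  ultimately show "(rel_on U ^^ k) u v"
    unfolding relpowp_fun_conv by (intro exI[of _ "(!) p"]) auto
next
  assume "(rel_on U ^^ k) u v"
  then obtain f where f: "f 0 = u" "f k = v" "\<And>i. i < k \<Longrightarrow> rel_on U (f i) (f (Suc i))"
    unfolding relpowp_fun_conv by blast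
  define p where "p = map f [0..<Suc k]"
  have p: "p \<noteq> []" "length p = Suc k" "\<And>i. i \<le> k \<Longrightarrow> p ! i = f i"
    unfolding p_def by (auto simp del: upt_Suc)
  have fU: "f i \<in> U" if "i \<le> k" for i
  proof (cases i)
    case 0
    then show ?thesis using f(1) assms by simp
  next
    case (Suc i')
    then show ?thesis using f(3)[of i'] that by (simp add: rel_on_def)
  qed
  have "set p \<subseteq> U" unfolding p_def using fU by (auto simp del: upt_Suc)
  moreover have "successively (\<lambda>u v. {u, v} \<in> induced_edges E U) p"
    unfolding successively_conv_nth using f(3) p
    by (auto simp: rel_on_def induced_edges_def)
  moreover have "hd p = u" "last p = v"
    using p f by (auto simp: hd_conv_nth last_conv_nth)
  ultimately show "\<exists>p. walk_between U (induced_edges E U) u p v \<and> length p = Suc k"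
    using p by (intro exI[of _ p]) (simp add: walk_between_def graph_walk_def)
qed

lemma graph_connected_iff: "graph_connected U (induced_edges E U) \<longleftrightarrow> conn U"
proof -
  have "(\<exists>p. walk_between U (induced_edges E U) u p v) \<longleftrightarrow> (rel_on U)\<^sup>*\<^sup>* u v" if "u \<in> U" for u v
  proof
    assume "\<exists>p. walk_between U (induced_edges E U) u p v"
    then obtain p where p: "walk_between U (induced_edges E U) u p v" by blast
    then obtain k where "length p = Suc k"
      by (cases p) (auto simp: walk_between_def graph_walk_def)
    then have "(rel_on U ^^ k) u v" using walk_iff_relpow[OF that] p by blast
    then show "(rel_on U)\<^sup>*\<^sup>* u v" by (rule relpowp_imp_rtranclp)
  next
    assume "(rel_on U)\<^sup>*\<^sup>* u v"
    then obtain k where "(rel_on U ^^ k) u v" using rtranclp_imp_relpowp by metis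
    then show "\<exists>p. walk_between U (induced_edges E U) u p v" using walk_iff_relpow[OF that] by blast
  qed
  then show ?thesis unfolding graph_connected_def conn_def by simp
qed

lemma graph_dist_eq: "u \<in> U \<Longrightarrow> graph_dist U (induced_edges E U) u v = dst U u v"
  unfolding graph_dist_def dst_def by (simp add: walk_iff_relpow)

end

lemma induced_edges_self: "\<forall>e\<in>E. e \<subseteq> V \<Longrightarrow> induced_edges E V = E"
  by (auto simp: induced_edges_def)

text \<open>Serves to exclude cycles of parent edges: at a vertex of greatest \<open>d\<close> on
  the cycle, both neighbours would have to be its parent.\<close>

lemma graph_cycle_two_neighbours:
  assumes c: "graph_cycle V F c" and x: "x \<in> set c"
  obtains y z where "y \<in> set c" "z \<in> set c" "y \<noteq> z" "{x, y} \<in> F" "{x, z} \<in> F"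
proof -
  define n where "n = length c"
  have n: "3 \<le> n" "distinct c" "{last c, hd c} \<in> F"
    and edge: "\<And>i. Suc i < n \<Longrightarrow> {c ! i, c ! Suc i} \<in> F"
    using c by (auto simp: graph_cycle_def graph_walk_def successively_conv_nth n_def)
  have closing: "{c ! (n - 1), c ! 0} \<in> F"
  proof -
    have "c \<noteq> []" using n(1) by (auto simp: n_def)
    then have "last c = c ! (n - 1)" "hd c = c ! 0"
      by (simp_all add: n_def last_conv_nth hd_conv_nth)
    then show ?thesis using n(3) by (simp only:)
  qed
  obtain i where i: "i < n" "x = c ! i" using x by (auto simp: in_set_conv_nth n_def)
  \<comment> \<open>Cyclic successor and predecessor of \<open>i\<close>; they differ because the
    cycle has at least three vertices.\<close>
  define s where "s = (if Suc i < n then Suc i else 0)"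
  define t where "t = (if i = 0 then n - 1 else i - 1)"
  have st: "s < n" "t < n" "s \<noteq> t" using n i by (auto simp: s_def t_def)
  have "{x, c ! s} \<in> F"
  proof (cases "Suc i < n")
    case True
    then show ?thesis using edge[of i] i by (simp add: s_def)
  next
    case False
    then have "i = n - 1" using i by simp
    then show ?thesis using closing False i by (simp add: s_def)
  qed
  moreover have "{x, c ! t} \<in> F"
  proof (cases i)
    case 0
    then show ?thesis using closing i by (simp add: t_def insert_commute)
  next
    case (Suc i')
    then show ?thesis using edge[of i'] i by (simp add: t_def insert_commute)
  qed
  moreover have "c ! s \<noteq> c ! t" using st n by (simp add: nth_eq_iff_index_eq n_def)
  moreover have "c ! s \<in> set c" "c ! t \<in> set c" using st by (simp_all add: n_def)
  ultimately show ?thesis using that by blast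
qed

context edge_graph
begin

section \<open>The bijection between arborescences and spanning trees\<close>

definition parent_edges :: "'a set \<Rightarrow> 'a \<Rightarrow> ('a \<Rightarrow> 'a) \<Rightarrow> 'a set set" where
  "parent_edges V r P = (\<lambda>v. {v, P v}) ` (V - {r})"

lemma arborescencesE:
  assumes "P \<in> arborescences V r"
  obtains d :: "'a \<Rightarrow> nat" where "\<And>v. v \<in> V - {r} \<Longrightarrow> P v \<in> V" "\<And>v. v \<in> V - {r} \<Longrightarrow> {v, P v} \<in> E"
    "\<And>v. v \<in> V - {r} \<Longrightarrow> d (P v) < d v" "P \<in> extensional (V - {r})"
  using assms unfolding arborescences_def PiE_iff by blast

lemma parent_edges_subset:
  assumes "P \<in> arborescences V r"
  shows "parent_edges V r P \<subseteq> E"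
  using assms by (elim arborescencesE) (auto simp: parent_edges_def)

lemma parent_edges_conn:
  assumes P: "P \<in> arborescences V r" and r: "r \<in> V"
  shows "adjacency.conn (\<lambda>u v. {u, v} \<in> parent_edges V r P) V"
proof -
  interpret F: edge_graph "parent_edges V r P"
    by (rule edge_graph_subset[OF parent_edges_subset[OF P]])
  obtain d :: "'a \<Rightarrow> nat" where d: "\<And>v. v \<in> V - {r} \<Longrightarrow> P v \<in> V" "\<And>v. v \<in> V - {r} \<Longrightarrow> d (P v) < d v"
    using arborescencesE[OF P] by metis
  show "F.conn V"
  proof (rule F.connI)
    fix t assume "t \<in> V"
    then show "(F.rel_on V)\<^sup>*\<^sup>* t r"
    proof (induction "d t" arbitrary: t rule: less_induct)
      case less
      show ?case
      proof (cases "t = r")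
        case False
        then have t: "t \<in> V - {r}" using less by simp
        then have "{t, P t} \<in> parent_edges V r P" by (auto simp: parent_edges_def)
        then have "F.rel_on V t (P t)"
          unfolding F.rel_on_def using d(1)[OF t] t by blast
        moreover have "(F.rel_on V)\<^sup>*\<^sup>* (P t) r" using less(1)[OF d(2)[OF t] d(1)[OF t]] .
        ultimately show ?thesis by (rule converse_rtranclp_into_rtranclp)
      qed simp
    qed
  qed
qed

lemma parent_edges_spanning_tree:
  assumes E: "\<forall>e\<in>E. e \<subseteq> V" and P: "P \<in> arborescences V r" and r: "r \<in> V"
  shows "parent_edges V r P \<in> spanning_trees V E"
proof -
  interpret F: edge_graph "parent_edges V r P"
    by (rule edge_graph_subset[OF parent_edges_subset[OF P]])
  have "\<forall>e\<in>parent_edges V r P. e \<subseteq> V" using E parent_edges_subset[OF P] by blast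
  then have "graph_connected V (parent_edges V r P)"
    using F.graph_connected_iff[of V] parent_edges_conn[OF P r] by (simp add: induced_edges_self)
  moreover have "\<not> graph_cycle V (parent_edges V r P) c" for c
  proof
    assume c: "graph_cycle V (parent_edges V r P) c"
    obtain d :: "'a \<Rightarrow> nat" where d: "\<And>v. v \<in> V - {r} \<Longrightarrow> d (P v) < d v"
      using arborescencesE[OF P] by metis
    have ne: "set c \<noteq> {}" using c by (auto simp: graph_cycle_def)
    have "Max (d ` set c) \<in> d ` set c" by (rule Max_in) (use ne in auto)
    then obtain x where x: "x \<in> set c" "d x = Max (d ` set c)" by force
    have le: "d y \<le> d x" if "y \<in> set c" for y unfolding x(2) using that by (intro Max_ge) auto
    have parent: "y = P x" if y: "y \<in> set c" "{x, y} \<in> parent_edges V r P" for y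
    proof -
      obtain v where v: "v \<in> V - {r}" "{x, y} = {v, P v}"
        using y(2) unfolding parent_edges_def by blast
      then consider "x = v" "y = P v" | "x = P v" "y = v" by (auto simp: doubleton_eq_iff)
      then show ?thesis
      proof cases
        case 2
        then show ?thesis using d[OF v(1)] le[OF y(1)] by simp
      qed simp
    qed
    show False using graph_cycle_two_neighbours[OF c x(1)] parent by metis
  qed
  ultimately show ?thesis
    using parent_edges_subset[OF P] by (auto simp: spanning_trees_def graph_tree_def)
qed

text \<open>Take a vertex \<open>v\<close> of least \<open>d\<close> at which \<open>P\<close> and
  \<open>Q\<close> differ. The edge from \<open>v\<close> to \<open>u = P v\<close> must come from
  \<open>Q u = v\<close>, but \<open>P u = v\<close> would contradict the decrease of
  \<open>d\<close>. So \<open>P\<close> and \<open>Q\<close> differ at \<open>u\<close>, where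
  \<open>d\<close> is smaller.\<close>

lemma parent_edges_inj:
  assumes P: "P \<in> arborescences V r" and Q: "Q \<in> arborescences V r"
    and eq: "parent_edges V r P = parent_edges V r Q"
  shows "P = Q"
proof (rule ccontr)
  assume "P \<noteq> Q"
  obtain d :: "'a \<Rightarrow> nat" where d: "\<And>v. v \<in> V - {r} \<Longrightarrow> P v \<in> V" "\<And>v. v \<in> V - {r} \<Longrightarrow> d (P v) < d v"
    "P \<in> extensional (V - {r})"
    using arborescencesE[OF P] by metis
  have "Q \<in> extensional (V - {r})" using arborescencesE[OF Q] by metis
  then obtain v0 where "v0 \<in> V - {r} \<and> P v0 \<noteq> Q v0" using \<open>P \<noteq> Q\<close> d(3) extensionalityI by metis
  then obtain v where v: "v \<in> V - {r}" "P v \<noteq> Q v"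
    and min: "\<And>u. u \<in> V - {r} \<Longrightarrow> P u \<noteq> Q u \<Longrightarrow> d v \<le> d u"
    using arg_min_nat_lemma[of "\<lambda>v. v \<in> V - {r} \<and> P v \<noteq> Q v" v0 d] by blast
  have "{v, P v} \<in> parent_edges V r P" unfolding parent_edges_def by (rule imageI[OF v(1)])
  then have "{v, P v} \<in> parent_edges V r Q" unfolding eq .
  then obtain u where u: "u \<in> V - {r}" "{v, P v} = {u, Q u}" unfolding parent_edges_def by blast
  then have Pv: "u = P v" "Q u = v" using v(2) by (auto simp: doubleton_eq_iff)
  have less: "d u < d v" using d(2)[OF v(1)] Pv(1) by simp
  have "P u \<noteq> v"
  proof
    assume "P u = v"
    then show False using d(2)[OF u(1)] less by simp
  qed
  then show False using min[OF u(1)] Pv(2) less by simp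
qed

text \<open>The parent of \<open>x\<close> is a neighbour in \<open>F\<close> closer to
  \<open>r\<close>. The parent edges already connect \<open>V\<close>, so any further edge of
  \<open>F\<close> would close a cycle with a path of parent edges.\<close>

lemma parent_edges_surj:
  assumes E: "\<forall>e\<in>E. e \<subseteq> V" and r: "r \<in> V" and F: "F \<in> spanning_trees V E"
  shows "\<exists>P\<in>arborescences V r. parent_edges V r P = F"
proof -
  have FE: "F \<subseteq> E" and tree: "graph_connected V F" "\<And>c. \<not> graph_cycle V F c"
    using F by (auto simp: spanning_trees_def graph_tree_def)
  interpret F: edge_graph F by (rule edge_graph_subset[OF FE])
  have FV: "\<forall>e\<in>F. e \<subseteq> V" using E FE by blast
  have conn: "F.conn V" using tree(1) F.graph_connected_iff[of V] by (simp add: induced_edges_self[OF FV])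
  have "\<exists>w. w \<in> V \<and> {x, w} \<in> F \<and> F.dst V w r < F.dst V x r" if x: "x \<in> V - {r}" for x
  proof -
    have xV: "x \<in> V" "x \<noteq> r" using x by auto
    then obtain k where k: "F.dst V x r = Suc k"
      using F.dst_eq_0[OF conn xV(1) r] by (cases "F.dst V x r") auto
    obtain w where "w \<in> V" "{x, w} \<in> F" "F.dst V w r = k" by (rule F.dst_SucE[OF conn xV(1) r k])
    then show ?thesis using k by (intro exI[of _ w]) simp
  qed
  then have "\<forall>x\<in>V - {r}. \<exists>w. w \<in> V \<and> {x, w} \<in> F \<and> F.dst V w r < F.dst V x r" by blast
  then obtain par where par: "\<forall>x\<in>V - {r}. par x \<in> V \<and> {x, par x} \<in> F \<and>
      F.dst V (par x) r < F.dst V x r"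
    by (rule bchoice[THEN exE])
  define P where "P = restrict par (V - {r})"
  have Px: "P x = par x" if "x \<in> V - {r}" for x using that by (simp add: P_def)
  have "P \<in> (\<Pi>\<^sub>E v\<in>V - {r}. {u \<in> V. {v, u} \<in> E})"
    unfolding PiE_iff using par Px FE P_def by auto
  moreover have "\<forall>x\<in>V - {r}. F.dst V (P x) r < F.dst V x r" using par Px by simp
  ultimately have P: "P \<in> arborescences V r"
    unfolding arborescences_def by (intro CollectI conjI exI[of _ "\<lambda>x. F.dst V x r"])
  define T where "T = parent_edges V r P"
  have TF: "T \<subseteq> F" using par Px by (auto simp: T_def parent_edges_def)
  interpret T: edge_graph T by (rule F.edge_graph_subset[OF TF])
  have connT: "T.conn V" unfolding T_def by (rule parent_edges_conn[OF P r])
  have "e \<in> T" if e: "e \<in> F" for e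
  proof (rule ccontr)
    assume "e \<notin> T"
    obtain x y where xy: "e = {x, y}" "x \<noteq> y" using F.edgeE[OF e] by metis
    have V: "x \<in> V" "y \<in> V" using FV e xy by auto
    obtain p where p: "p \<noteq> []" "hd p = x" "last p = y" "length p = Suc (T.dst V x y)"
      "successively (\<lambda>u v. {u, v} \<in> T) p" "distinct p" "set p \<subseteq> V"
      using T.dst_path[OF connT V(2) V(1) refl] by blast
    have "T.dst V x y \<noteq> 0" using T.dst_eq_0[OF connT V] xy by simp
    moreover have "T.dst V x y \<noteq> Suc 0" using T.dst_eq_1[OF connT V] xy \<open>e \<notin> T\<close> by simp
    ultimately have "length p \<ge> 3" using p(4) by linarith
    moreover have "successively (\<lambda>u v. {u, v} \<in> F) p"
      using p(5) by (rule successively_mono) (use TF in auto)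
    moreover have "{last p, hd p} \<in> F" using e xy p by (simp add: insert_commute)
    ultimately have "graph_cycle V F p" using p by (simp add: graph_cycle_def graph_walk_def)
    then show False using tree(2) by blast
  qed
  then have "T = F" using TF by blast
  then show ?thesis using P unfolding T_def by blast
qed

lemma bij_betw_parent_edges:
  assumes "\<forall>e\<in>E. e \<subseteq> V" "r \<in> V"
  shows "bij_betw (parent_edges V r) (arborescences V r) (spanning_trees V E)"
  unfolding bij_betw_def
proof
  show "inj_on (parent_edges V r) (arborescences V r)"
    using parent_edges_inj by (auto intro: inj_onI)
  show "parent_edges V r ` arborescences V r = spanning_trees V E"
    using parent_edges_spanning_tree[OF assms(1) _ assms(2)] parent_edges_surj[OF assms] by blast
qed

text \<open>The edges at \<open>v\<close> lead to its children and, unless \<open>v\<close> is the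
  root, to its parent. No edge arises from two vertices, since \<open>d\<close> would decrease in
  both directions.\<close>

lemma edge_degree_parent_edges:
  assumes V: "finite V" and P: "P \<in> arborescences V r"
  shows "edge_degree (parent_edges V r P) v =
    card {x \<in> V - {r}. P x = v} + (if v \<in> V - {r} then 1 else 0)"
proof -
  obtain d :: "'a \<Rightarrow> nat" where d: "\<And>v. v \<in> V - {r} \<Longrightarrow> d (P v) < d v"
    using arborescencesE[OF P] by metis
  have neq: "P v \<noteq> v" if "v \<in> V - {r}" for v using d[OF that] by auto
  define X where "X = {x \<in> V - {r}. P x = v}"
  define Y where "Y = (if v \<in> V - {r} then {v} else {})"
  have fin: "finite X" "finite Y" using V by (auto simp: X_def Y_def)
  have XY: "X \<inter> Y = {}" using neq by (auto simp: X_def Y_def split: if_splits)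
  have inj: "inj_on (\<lambda>v. {v, P v}) (V - {r})"
  proof (rule inj_onI)
    fix x y assume xy: "x \<in> V - {r}" "y \<in> V - {r}" "{x, P x} = {y, P y}"
    show "x = y"
    proof (rule ccontr)
      assume "x \<noteq> y"
      then have "x = P y" "y = P x" using xy(3) by (auto simp: doubleton_eq_iff)
      then show False using d[OF xy(1)] d[OF xy(2)] by simp
    qed
  qed
  have "{e \<in> parent_edges V r P. v \<in> e} = (\<lambda>v. {v, P v}) ` (X \<union> Y)"
    unfolding parent_edges_def X_def Y_def by (auto split: if_splits)
  then have "edge_degree (parent_edges V r P) v = card ((\<lambda>v. {v, P v}) ` (X \<union> Y))"
    by (simp add: edge_degree_def)
  also have "\<dots> = card (X \<union> Y)"
    by (rule card_image, rule inj_on_subset[OF inj]) (auto simp: X_def Y_def)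
  also have "\<dots> = card X + card Y" by (rule card_Un_disjoint[OF fin XY])
  finally show ?thesis by (simp add: X_def Y_def)
qed

text \<open>The factor \<open>z v\<close> occurs once for each child of \<open>v\<close>, which is
  the degree minus one except at the root. The root has no parent, hence the additional
  \<open>z r\<close>; for a single vertex the product is empty.\<close>

lemma prod_parents:
  fixes z :: "'a \<Rightarrow> complex"
  assumes V: "finite V" "r \<in> V" and P: "P \<in> arborescences V r"
  shows "(\<Prod>v\<in>V - {r}. z (P v)) =
    (if V = {r} then 1 else z r) * (\<Prod>v\<in>V. z v ^ (edge_degree (parent_edges V r P) v - 1))"
proof (cases "V = {r}")
  case True
  have "edge_degree (parent_edges V r P) r = 0"
    using edge_degree_parent_edges[OF V(1) P, of r] True by simp
  then show ?thesis unfolding True by simp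
next
  case False
  obtain d :: "'a \<Rightarrow> nat" where d: "\<And>v. v \<in> V - {r} \<Longrightarrow> P v \<in> V" "\<And>v. v \<in> V - {r} \<Longrightarrow> d (P v) < d v"
    using arborescencesE[OF P] by metis
  define m where "m v = card {x \<in> V - {r}. P x = v}" for v
  obtain v0 where "v0 \<in> V - {r}" using False V by blast
  then obtain v where v: "v \<in> V - {r}" "\<And>u. u \<in> V - {r} \<Longrightarrow> d v \<le> d u"
    using arg_min_nat_lemma[of "\<lambda>v. v \<in> V - {r}" v0 d] by blast
  \<comment> \<open>A non-root vertex of least \<open>d\<close> is a child of \<open>r\<close>. So
    \<open>r\<close> has positive degree, and the truncated subtraction in its exponent is
    exact.\<close>
  have "P v = r" using d[OF v(1)] v(2)[of "P v"] by force
  then have "v \<in> {x \<in> V - {r}. P x = r}" using v(1) by simp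
  then have mr: "m r \<noteq> 0" using V unfolding m_def by (auto simp: card_eq_0_iff)
  have "(\<Prod>x\<in>V - {r}. z (P x)) = (\<Prod>v\<in>V. \<Prod>x\<in>{x \<in> V - {r}. P x = v}. z (P x))"
    by (rule prod.group[symmetric]) (use V d in auto)
  also have "\<dots> = (\<Prod>v\<in>V. z v ^ m v)" by (intro prod.cong) (auto simp: m_def)
  also have "\<dots> = z r ^ m r * (\<Prod>v\<in>V - {r}. z v ^ m v)" by (rule prod.remove[OF V])
  also have "z r ^ m r = z r * z r ^ (m r - 1)" using mr by (cases "m r") auto
  also have "(\<Prod>v\<in>V - {r}. z v ^ m v) =
      (\<Prod>v\<in>V - {r}. z v ^ (edge_degree (parent_edges V r P) v - 1))"
    by (intro prod.cong refl) (simp add: edge_degree_parent_edges[OF V(1) P] m_def)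
  also have "m r = edge_degree (parent_edges V r P) r"
    by (simp add: edge_degree_parent_edges[OF V(1) P] m_def)
  finally show ?thesis using False by (simp add: prod.remove[OF V] mult.assoc)
qed

end

section \<open>Evaluation of the vertex spanning polynomial\<close>

lemma mpoly_eval_superset:
  assumes "finite K" "Poly_Mapping.keys P \<subseteq> K"
  shows "mpoly_eval z P = (\<Sum>m\<in>K. complex_of_real (Poly_Mapping.lookup P m) *
    (\<Prod>v\<in>Poly_Mapping.keys m. z v ^ Poly_Mapping.lookup m v))"
  unfolding mpoly_eval_def
  by (rule sum.mono_neutral_left[OF assms]) (auto simp: in_keys_iff)

lemma mpoly_eval_add: "mpoly_eval z (P + Q) = mpoly_eval z P + mpoly_eval z Q"
proof -
  let ?K = "Poly_Mapping.keys P \<union> Poly_Mapping.keys Q"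
  have K: "finite ?K" "Poly_Mapping.keys (P + Q) \<subseteq> ?K" by (simp_all add: Poly_Mapping.keys_add)
  show ?thesis
    unfolding mpoly_eval_superset[OF K] mpoly_eval_superset[OF K(1) Un_upper1]
      mpoly_eval_superset[OF K(1) Un_upper2] sum.distrib[symmetric]
    by (intro sum.cong) (auto simp: lookup_add distrib_right)
qed

lemma mpoly_eval_sum: "mpoly_eval z (\<Sum>F\<in>S. f F) = (\<Sum>F\<in>S. mpoly_eval z (f F))"
proof -
  have "mpoly_eval z 0 = 0" by (simp add: mpoly_eval_def)
  then show ?thesis by (induction S rule: infinite_finite_induct) (simp_all add: mpoly_eval_add)
qed

lemma mpoly_eval_monomial:
  assumes "finite V"
  shows "mpoly_eval z (Poly_Mapping.single (\<Sum>v\<in>V. Poly_Mapping.single v (n v)) 1) =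
    (\<Prod>v\<in>V. z v ^ n v)"
proof -
  let ?m = "\<Sum>v\<in>V. Poly_Mapping.single v (n v)"
  have m: "Poly_Mapping.lookup ?m u = (if u \<in> V then n u else 0)" for u
    using assms by (simp add: lookup_sum lookup_single when_def)
  have "mpoly_eval z (Poly_Mapping.single ?m 1) =
      (\<Prod>v\<in>Poly_Mapping.keys ?m. z v ^ Poly_Mapping.lookup ?m v)"
    by (simp add: mpoly_eval_def)
  also have "\<dots> = (\<Prod>v\<in>V. z v ^ Poly_Mapping.lookup ?m v)"
    by (rule prod.mono_neutral_left[OF assms]) (auto simp: in_keys_iff m split: if_splits)
  also have "\<dots> = (\<Prod>v\<in>V. z v ^ n v)" by (intro prod.cong) (simp_all add: m)
  finally show ?thesis .
qed

lemma mpoly_eval_vertex_spanning_poly: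
  assumes "finite V"
  shows "mpoly_eval z (vertex_spanning_poly V E) =
    (\<Sum>F\<in>spanning_trees V E. \<Prod>v\<in>V. z v ^ (edge_degree F v - 1))"
  unfolding vertex_spanning_poly_def mpoly_eval_sum by (simp add: mpoly_eval_monomial[OF assms])

lemma (in edge_graph) tree_sum_eq_mpoly_eval:
  assumes V: "finite V" "r \<in> V" and E: "\<forall>e\<in>E. e \<subseteq> V"
  shows "tree_sum V r z = (if V = {r} then 1 else z r) * mpoly_eval z (vertex_spanning_poly V E)"
  unfolding tree_sum_def mpoly_eval_vertex_spanning_poly[OF V(1)]
    sum.reindex_bij_betw[OF bij_betw_parent_edges[OF E V(2)], symmetric] sum_distrib_left
  by (intro sum.cong refl prod_parents[OF V])

theorem theorem1:
  fixes V :: "'a set" and E :: "'a set set"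
  assumes "simple_graph V E" and "graph_connected V E"
  shows "stable_graph V E \<longleftrightarrow> distance_hereditary V E"
proof -
  have V: "finite V" "V \<noteq> {}" and E: "\<forall>e\<in>E. e \<subseteq> V" "\<And>e. e \<in> E \<Longrightarrow> card e = 2"
    using assms(1) by (auto simp: simple_graph_def)
  interpret edge_graph E by unfold_locales (rule E(2))
  obtain r where r: "r \<in> V" using V(2) by blast
  note EV = induced_edges_self[OF E(1)]
  have conn: "conn V" using assms(2) graph_connected_iff[of V] by (simp add: EV)
  have nonzero: "mpoly_eval z (vertex_spanning_poly V E) \<noteq> 0 \<longleftrightarrow> tree_sum V r z \<noteq> 0"
    if "\<forall>v\<in>V. 0 < Im (z v)" for z
  proof -
    have "z r \<noteq> 0" using that r by force
    then show ?thesis unfolding tree_sum_eq_mpoly_eval[OF V(1) r E(1)] by simp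
  qed
  have "stable_graph V E \<longleftrightarrow> rigid V"
    unfolding stable_graph_def real_stable_def rigid_iff_tree_sum[OF V(1) r]
    by (intro iff_allI imp_cong refl nonzero)
  also have "\<dots> \<longleftrightarrow> dist_hered V"
  proof
    assume rigid: "rigid V"
    show "dist_hered V"
    proof (rule ccontr)
      assume "\<not> dist_hered V"
      then obtain W where "W \<subseteq> V" "obstruction W" using not_dist_hered_obstruction[OF conn] by blast
      then show False using rigid_subset[OF V(1) conn rigid] unfolding obstruction_def by blast
    qed
  qed (rule dist_hered_imp_rigid[OF V(1) conn])
  also have "\<dots> \<longleftrightarrow> distance_hereditary V E"
  proof -
    have "dst W u v = dst V u v \<longleftrightarrow> graph_dist W (induced_edges E W) u v = graph_dist V E u v"
      if "W \<subseteq> V" "u \<in> W" for W u v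
      using graph_dist_eq[of u W v] graph_dist_eq[of u V v] that by (auto simp: EV)
    then show ?thesis
      unfolding dist_hered_def distance_hereditary_def graph_connected_iff
      by (intro iff_allI imp_cong ball_cong refl)
  qed
  finally show ?thesis .
qed

end
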